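(* There exist absolute constants $c>0$ and $p_0$ such that for every prime $p\ge p_0$ and every integer $N$ with $2\le N<p$ we have $$d_p(N)\ \ge\ c\left(\frac{N}{p^{1/2}\log p}\right)^{1/10}.$$
   Context: For an odd prime $p$, $\left(\frac{n}{p}\right)$ denotes the Legendre symbol (with $\left(\frac{0}{p}\right)=0$), and the Fekete polynomial is $F_p(X)=\sum_{n=0}^{p-1}\left(\frac{n}{p}\right)X^n\in\mathbb{Z}[X]$. For an integer $N\ge 2$, $d_p(N)$ denotes the smallest integer $d$ such that $F_p(X)\equiv G(X)\pmod{X^N}$ for some formal power series $G(X)=\sum_{n\ge0}A_nX^n\in\mathbb{C}[[X]]$ satisfying $h(X,G(X))=0$ for some nonzero polynomial $h(X,Y)\in\mathbb{C}[X,Y]$ of degree at most $d$ in each of the variables $X$ and $Y$. *)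

theory Defs
  imports
    Complex_Main
    "HOL-Number_Theory.Residues"
    "HOL-Computational_Algebra.Computational_Algebra"
begin

definition fekete_poly :: "nat \<Rightarrow> int poly" where
  "fekete_poly p = (\<Sum>n<p. Polynomial.monom (Legendre (int n) (int p)) n)"

text \<open>
  A bivariate polynomial \<open>h(X,Y)\<close> is an element of \<open>\<complex>[X][Y]\<close>: the outer variable is \<open>Y\<close>,
  and the coefficients are polynomials in \<open>X\<close>.
\<close>

definition degrees_le :: "complex poly poly \<Rightarrow> nat \<Rightarrow> bool" where
  "degrees_le h d \<longleftrightarrow>
     Polynomial.degree h \<le> d \<and> (\<forall>j. Polynomial.degree (Polynomial.coeff h j) \<le> d)"

definition subst_fps :: "complex poly poly \<Rightarrow> complex fps \<Rightarrow> complex fps" where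
  "subst_fps h G = poly (map_poly fps_of_poly h) G"

definition algebraic_fps_le :: "complex fps \<Rightarrow> nat \<Rightarrow> bool" where
  "algebraic_fps_le G d \<longleftrightarrow> (\<exists>h. h \<noteq> 0 \<and> degrees_le h d \<and> subst_fps h G = 0)"

definition fekete_approximable :: "nat \<Rightarrow> nat \<Rightarrow> nat \<Rightarrow> bool" where
  "fekete_approximable p N d \<longleftrightarrow>
     (\<exists>G. fps_X ^ N dvd (fps_of_poly (map_poly of_int (fekete_poly p)) - G) \<and>
          algebraic_fps_le G d)"

definition fekete_alg_degree :: "nat \<Rightarrow> nat \<Rightarrow> nat" where
  "fekete_alg_degree p N = (LEAST d. fekete_approximable p N d)"

text \<open>The minimum is taken over a nonempty set, as \<open>G = F\<^sub>p\<close> is a root of \<open>Y - F\<^sub>p(X)\<close>.\<close>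

lemma fekete_approximable_exists: "\<exists>d. fekete_approximable p N d"
proof -
  define F :: "complex poly" where "F = map_poly of_int (fekete_poly p)"
  define h where "h = [:- F, 1:]"
  have "h \<noteq> 0"
    by (simp add: h_def)
  moreover have "degrees_le h (max 1 (Polynomial.degree F))"
    by (auto simp: degrees_le_def h_def coeff_pCons split: nat.split)
  moreover have "subst_fps h (fps_of_poly F) = 0"
    by (simp add: subst_fps_def h_def map_poly_pCons fps_of_poly_uminus)
  ultimately have "algebraic_fps_le (fps_of_poly F) (max 1 (Polynomial.degree F))"
    unfolding algebraic_fps_le_def by blast
  moreover have "fps_X ^ N dvd (fps_of_poly F - fps_of_poly F)"
    by simp
  ultimately show ?thesis
    unfolding fekete_approximable_def F_def by blast
qed

end

theory Submission
  imports Defs "HOL-Number_Theory.Number_Theory"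
begin

text \<open>
  Let \<open>F = F\<^sub>p\<close> be approximated modulo \<open>X\<^sup>N\<close> by an algebraic series of bidegree \<open>d\<close>, so that
  \<open>h(X, F) = O(X\<^sup>N)\<close>. For \<open>w\<close> away from finitely many moduli, \<open>F - w\<close> divides \<open>h(X, w) - h(X, F)\<close>, a
  polynomial of degree at most \<open>d\<close> plus terms from \<open>X\<^sup>N\<close> on; hence \<open>F\<close> takes the value \<open>w\<close> at most \<open>d\<close>
  times in the disc of radius \<open>r = 1 - s\<close>, \<open>s = 32 d ln p / N\<close>. Applying Jensen's formula to \<open>F - w\<close> and
  averaging over circles \<open>|w| = R\<close>, the means of \<open>ln max(|F|, R)\<close> over \<open>|z| = r\<close> grow at rate at most
  \<open>d\<close> in \<open>ln r\<close>. A weighted sum over dyadic \<open>R\<close> up to about \<open>sqrt p\<close> turns \<open>ln max(|F|, R)\<close> into something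
  comparable to \<open>|F|\<^sup>2\<close>, provided that \<open>|F|\<close> is rarely larger than \<open>sqrt p\<close>. The latter holds because the
  functional equation of the Gauss sum confines \<open>F\<close> to a strip of width \<open>4 sqrt p\<close>, so that the fourth
  moment of \<open>F\<close> is at most \<open>32 p\<close> times the second. Since the second moment is about \<open>1/(2s)\<close>, this
  yields \<open>1/s = O(p d s)\<close>, that is \<open>N = O(d\<^bsup>3/2\<^esup> p\<^bsup>1/2\<^esup> ln p)\<close>.
\<close>

section \<open>Quadratic Gauss sums\<close>

lemma Legendre_cong: "[a = b] (mod p) \<Longrightarrow> Legendre a p = Legendre b p"
proof -
  assume ab: "[a = b] (mod p)"
  have "[a = 0] (mod p) \<longleftrightarrow> [b = 0] (mod p)"
    using ab by (meson cong_sym cong_trans)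
  moreover have "QuadRes p a \<longleftrightarrow> QuadRes p b"
    unfolding QuadRes_def using ab by (meson cong_sym cong_trans)
  ultimately show ?thesis by (simp add: Legendre_def)
qed

lemma Legendre_values: "Legendre a p \<in> {-1, 0, 1}"
  by (auto simp: Legendre_def)

text \<open>Euler's criterion gives the identity modulo \<open>p\<close>. Both sides lie in {-1, 0,
  1}, so they differ by at most 2, which is less than \<open>p\<close>.\<close>

lemma Legendre_mult:
  fixes p :: nat
  assumes "prime p" "2 < p"
  shows "Legendre (a * b) p = Legendre a p * Legendre b p"
proof -
  have "[Legendre (a * b) p = (a * b) ^ ((p - 1) div 2)] (mod p)"
    by (rule euler_criterion[OF assms])
  moreover have "[Legendre a p * Legendre b p = a ^ ((p - 1) div 2) * b ^ ((p - 1) div 2)] (mod p)"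
    by (intro cong_mult euler_criterion[OF assms])
  ultimately have "[Legendre (a * b) p = Legendre a p * Legendre b p] (mod p)"
    by (metis cong_sym cong_trans power_mult_distrib)
  then have "int p dvd Legendre (a * b) p - Legendre a p * Legendre b p"
    by (simp add: cong_iff_dvd_diff)
  moreover have "\<bar>Legendre (a * b) p - Legendre a p * Legendre b p\<bar> < int p"
    using Legendre_values[of "a * b" p] Legendre_values[of a p] Legendre_values[of b p] assms(2)
    by auto
  ultimately show ?thesis
    using dvd_imp_le_int[of "Legendre (a * b) p - Legendre a p * Legendre b p" "int p"] by fastforce
qed

text \<open>If every residue were a square, squaring would map \<open>{0..<p}\<close> onto itself
  and hence be injective there. But 1 and \<open>p - 1\<close> are distinct and have the same
  square.\<close>

lemma exists_Legendre_minus_one: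
  fixes p :: nat
  assumes "prime p" "2 < p"
  obtains c where "Legendre c p = -1"
proof (rule ccontr)
  assume no: "\<not> thesis"
  have "QuadRes p a" for a
  proof (cases "[a = 0] (mod p)")
    case True
    then have "[0\<^sup>2 = a] (mod p)" by (simp add: cong_sym)
    then show ?thesis unfolding QuadRes_def by blast
  next
    case False
    then show ?thesis using no that[of a] unfolding Legendre_def by presburger
  qed
  define f where "f = (\<lambda>y::int. y\<^sup>2 mod int p)"
  have "{0..<int p} \<subseteq> f ` {0..<int p}"
  proof
    fix a assume a: "a \<in> {0..<int p}"
    obtain y where y: "[y\<^sup>2 = a] (mod p)" using \<open>QuadRes p a\<close> by (auto simp: QuadRes_def)
    have "f (y mod int p) = a" using y a by (simp add: f_def cong_def power_mod)
    moreover have "y mod int p \<in> {0..<int p}" using assms by simp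
    ultimately show "a \<in> f ` {0..<int p}" by blast
  qed
  then have "inj_on f {0..<int p}"
    by (intro finite_surj_inj) auto
  moreover have "f 1 = f (int p - 1)"
  proof -
    have "(int p - 1)\<^sup>2 = 1 + int p * (int p - 2)" by (simp add: power2_eq_square algebra_simps)
    then show ?thesis unfolding f_def by (metis mod_mult_self2 one_power2)
  qed
  ultimately have "1 = int p - 1" using assms by (auto dest: inj_onD[of f _ 1 "int p - 1"])
  then show False using assms by simp
qed

section \<open>Additive characters and their orthogonality\<close>

definition unity_char :: "nat \<Rightarrow> int \<Rightarrow> complex" where
  "unity_char p a = cis (2 * pi * of_int a / of_nat p)"

lemma unity_char_add: "unity_char p (a + b) = unity_char p a * unity_char p b"
  by (simp add: unity_char_def cis_mult ring_distribs add_divide_distrib)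

lemma unity_char_minus: "unity_char p (- a) = cnj (unity_char p a)"
  by (simp add: unity_char_def cis_cnj)

lemma norm_unity_char [simp]: "norm (unity_char p a) = 1"
  by (simp add: unity_char_def)

lemma unity_char_mult_nat: "unity_char p (a * int n) = unity_char p a ^ n"
  by (simp add: unity_char_def DeMoivre mult_ac)

lemma unity_char_power_p: "p > 0 \<Longrightarrow> unity_char p a ^ p = 1"
  unfolding unity_char_def by (simp add: DeMoivre cis_multiple_2pi)

lemma unity_char_eq_1_iff:
  assumes "p > 0"
  shows "unity_char p a = 1 \<longleftrightarrow> int p dvd a"
proof
  assume "unity_char p a = 1"
  then have "cos (2 * pi * of_int a / of_nat p) = 1"
    by (simp add: unity_char_def complex_eq_iff)
  then obtain m :: int where "2 * pi * of_int a / of_nat p = of_int m * 2 * pi"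
    by (subst (asm) cos_one_2pi_int) blast
  then have "real_of_int a = real_of_int (m * int p)"
    using assms by (simp add: field_simps)
  then have "a = m * int p" using of_int_eq_iff by blast
  then show "int p dvd a" by simp
next
  assume "int p dvd a"
  then obtain m where "a = int p * m" by auto
  then show "unity_char p a = 1"
    using assms cis_multiple_2pi[of "real_of_int m"] by (simp add: unity_char_def mult.assoc)
qed

lemma unity_char_cong:
  assumes "p > 0" "[a = b] (mod int p)"
  shows "unity_char p a = unity_char p b"
proof -
  have "int p dvd a - b" using assms by (simp add: cong_iff_dvd_diff)
  then have "unity_char p (a - b) = 1" using unity_char_eq_1_iff assms by blast
  then show ?thesis using unity_char_add[of p "a - b" b] by simp
qed

lemma sum_unity_char:
  assumes "p > 0"
  shows "(\<Sum>n<p. unity_char p (a * int n)) = (if int p dvd a then of_nat p else 0)"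
proof (cases "int p dvd a")
  case True
  then show ?thesis using unity_char_eq_1_iff[OF assms, of a] by (simp add: unity_char_mult_nat)
next
  case False
  then have "unity_char p a \<noteq> 1" using unity_char_eq_1_iff assms by blast
  then show ?thesis
    using False assms by (simp add: unity_char_mult_nat geometric_sum unity_char_power_p)
qed

text \<open>Multiplication by a unit permutes the residues, and periodicity of \<open>f\<close> lets
  the products be reduced modulo \<open>p\<close>.\<close>

lemma sum_residues_mult:
  fixes f :: "int \<Rightarrow> complex"
  assumes "p > 0" "coprime n (int p)" and per: "\<And>a b. [a = b] (mod int p) \<Longrightarrow> f a = f b"
  shows "(\<Sum>a\<in>{0..<int p}. f (n * a)) = (\<Sum>a\<in>{0..<int p}. f a)"
proof -
  define g where "g = (\<lambda>a. n * a mod int p)"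
  have inj: "inj_on g {0..<int p}"
  proof (rule inj_onI)
    fix a b assume ab: "a \<in> {0..<int p}" "b \<in> {0..<int p}" "g a = g b"
    then have "[n * a = n * b] (mod int p)" by (simp add: g_def cong_def)
    then have "[a = b] (mod int p)" using assms(2) by (simp add: cong_mult_lcancel)
    then show "a = b" using ab by (simp add: cong_def)
  qed
  have "g ` {0..<int p} = {0..<int p}"
    using inj assms(1) by (intro endo_inj_surj) (auto simp: g_def)
  then have "(\<Sum>a\<in>{0..<int p}. f a) = (\<Sum>a\<in>{0..<int p}. f (g a))"
    using sum.reindex[OF inj, of f] by simp
  also have "\<dots> = (\<Sum>a\<in>{0..<int p}. f (n * a))"
    by (intro sum.cong refl per) (simp add: g_def cong_def)
  finally show ?thesis by simp
qed

section \<open>The quadratic Gauss sum, its twists and its modulus\<close>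

definition quad_gauss_sum :: "nat \<Rightarrow> complex" where
  "quad_gauss_sum p = (\<Sum>a\<in>{0..<int p}. of_int (Legendre a p) * unity_char p a)"

context
  fixes p :: nat
  assumes p_prime: "prime p" and p_odd: "2 < p"
begin

lemma coprime_prime_iff: "coprime n (int p) \<longleftrightarrow> \<not> int p dvd n"
proof -
  have "prime (int p)" using p_prime by simp
  then show ?thesis
    by (metis coprime_absorb_right coprime_commute not_prime_unit prime_imp_coprime)
qed

lemma Legendre_square_eq_1: "coprime n (int p) \<Longrightarrow> Legendre n p * Legendre n p = 1"
  by (auto simp: coprime_prime_iff Legendre_def cong_0_iff)

text \<open>Replacing \<open>a\<close> by \<open>c * a\<close> with a nonresidue \<open>c\<close>
  leaves the sum unchanged and also flips its sign.\<close>

lemma sum_Legendre: "(\<Sum>a\<in>{0..<int p}. of_int (Legendre a p) :: complex) = 0"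
proof -
  obtain c where c: "Legendre c p = -1" using exists_Legendre_minus_one[OF p_prime p_odd] .
  have "coprime c (int p)"
  proof -
    have "\<not> int p dvd c" using c by (auto simp: Legendre_def cong_0_iff split: if_splits)
    then show ?thesis by (simp add: coprime_prime_iff)
  qed
  then have "(\<Sum>a\<in>{0..<int p}. of_int (Legendre (c * a) p) :: complex) = (\<Sum>a\<in>{0..<int p}. of_int (Legendre a p))"
    by (intro sum_residues_mult) (use p_odd Legendre_cong in auto)
  then have "- (\<Sum>a\<in>{0..<int p}. of_int (Legendre a p) :: complex) = (\<Sum>a\<in>{0..<int p}. of_int (Legendre a p))"
    by (simp add: Legendre_mult[OF p_prime p_odd] c sum_negf)
  then show ?thesis by simp
qed

text \<open>For \<open>n\<close> prime to \<open>p\<close>, substitute \<open>n * a\<close> for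
  \<open>a\<close> in the Gauss sum. For \<open>p\<close> dividing \<open>n\<close> both sides are
  0.\<close>

lemma gauss_sum_twist:
  "(\<Sum>a\<in>{0..<int p}. of_int (Legendre a p) * unity_char p (n * a)) = of_int (Legendre n p) * quad_gauss_sum p"
proof (cases "int p dvd n")
  case True
  then have "unity_char p (n * a) = 1" for a
    using p_odd by (subst unity_char_eq_1_iff) auto
  moreover have "Legendre n p = 0" using True by (simp add: Legendre_def cong_0_iff)
  ultimately show ?thesis using sum_Legendre by simp
next
  case False
  then have cop: "coprime n (int p)" by (simp add: coprime_prime_iff)
  have "quad_gauss_sum p = (\<Sum>a\<in>{0..<int p}. of_int (Legendre (n * a) p) * unity_char p (n * a))"
    unfolding quad_gauss_sum_def
    by (rule sum_residues_mult[OF _ cop, symmetric]) 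
       (use p_odd Legendre_cong unity_char_cong in auto)
  also have "\<dots> = of_int (Legendre n p) * (\<Sum>a\<in>{0..<int p}. of_int (Legendre a p) * unity_char p (n * a))"
    by (simp add: Legendre_mult[OF p_prime p_odd] sum_distrib_left mult_ac)
  finally have "of_int (Legendre n p) * quad_gauss_sum p = of_int (Legendre n p * Legendre n p) * (\<Sum>a\<in>{0..<int p}. of_int (Legendre a p) * unity_char p (n * a))"
    by (simp add: mult_ac)
  then show ?thesis using Legendre_square_eq_1[OF cop] by simp
qed

text \<open>The sum of \<open>|T n|^2\<close> over all \<open>n < p\<close> is computed twice: the
  twist formula gives \<open>p - 1\<close> times the squared modulus of the Gauss sum, and
  orthogonality of the characters gives \<open>p (p - 1)\<close>.\<close>

lemma norm_quad_gauss_sum: "(norm (quad_gauss_sum p))\<^sup>2 = real p"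
proof -
  define T where "T = (\<lambda>n::nat. \<Sum>a\<in>{0..<int p}. of_int (Legendre a p) * unity_char p (a * int n))"
  have L: "Legendre (int n) p * Legendre (int n) p = (if n = 0 then 0 else 1)" if "n < p" for n
  proof (cases "n = 0")
    case False
    then have "coprime (int n) (int p)"
      using that by (auto simp: coprime_prime_iff dest: dvd_imp_le)
    then show ?thesis using False Legendre_square_eq_1 by simp
  qed (simp add: Legendre_def)
  have sumL: "(\<Sum>n<p. of_int (Legendre (int n) p * Legendre (int n) p) :: complex) = of_nat (p - 1)"
  proof -
    have "(\<Sum>n<p. of_int (Legendre (int n) p * Legendre (int n) p) :: complex) = (\<Sum>n<p. if n = 0 then 0 else 1)"
      by (intro sum.cong refl) (use L in auto)
    also have "\<dots> = (\<Sum>n\<in>{1..<p}. 1)" by (rule sum.mono_neutral_cong_right) auto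
    finally show ?thesis by simp
  qed
  have "(\<Sum>n<p. T n * cnj (T n)) = of_nat (p - 1) * (quad_gauss_sum p * cnj (quad_gauss_sum p))"
  proof -
    have "T n = of_int (Legendre (int n) p) * quad_gauss_sum p" for n
      using gauss_sum_twist[of "int n"] by (simp add: T_def mult_ac)
    then have "(\<Sum>n<p. T n * cnj (T n)) = (\<Sum>n<p. of_int (Legendre (int n) p * Legendre (int n) p)) * (quad_gauss_sum p * cnj (quad_gauss_sum p))"
      by (simp only: sum_distrib_right) (simp add: mult_ac)
    then show ?thesis using sumL by simp
  qed
  moreover have "(\<Sum>n<p. T n * cnj (T n)) = of_nat p * of_nat (p - 1)"
  proof -
    have "(\<Sum>n<p. T n * cnj (T n)) = (\<Sum>n<p. \<Sum>a\<in>{0..<int p}. \<Sum>b\<in>{0..<int p}.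
        of_int (Legendre a p * Legendre b p) * unity_char p ((a - b) * int n))"
      unfolding T_def
      by (simp add: sum_product unity_char_minus[symmetric] unity_char_add[symmetric] algebra_simps
          flip: unity_char_add)
    also have "\<dots> = (\<Sum>a\<in>{0..<int p}. \<Sum>b\<in>{0..<int p}. \<Sum>n<p.
        of_int (Legendre a p * Legendre b p) * unity_char p ((a - b) * int n))"
      by (subst sum.swap, intro sum.cong refl, subst sum.swap, simp)
    also have "\<dots> = (\<Sum>a\<in>{0..<int p}. \<Sum>b\<in>{0..<int p}. of_int (Legendre a p * Legendre b p) * (if a = b then of_nat p else 0))"
    proof (intro sum.cong refl, goal_cases)
      case (1 a b)
      then have "int p dvd a - b \<longleftrightarrow> a = b"
        using mod_eq_dvd_iff[of a "int p" b] by auto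
      then show ?case using p_odd by (simp add: sum_distrib_left[symmetric] sum_unity_char)
    qed
    also have "\<dots> = (\<Sum>a\<in>{0..<int p}. of_int (Legendre a p * Legendre a p) * of_nat p)"
      by (simp add: if_distrib cong: if_cong)
    also have "\<dots> = (\<Sum>n<p. of_int (Legendre (int n) p * Legendre (int n) p) * of_nat p)"
      by (rule sum.reindex_bij_witness[of _ int nat]) auto
    also have "\<dots> = of_nat (p - 1) * of_nat p"
      using sumL by (simp only: sum_distrib_right[symmetric])
    finally show ?thesis by (simp add: mult_ac)
  qed
  ultimately have "of_nat (p - 1) * (quad_gauss_sum p * cnj (quad_gauss_sum p)) = of_nat (p - 1) * of_nat p"
    by (simp only: mult.commute)
  moreover have "(of_nat (p - 1) :: complex) \<noteq> 0"
    using p_odd by (subst of_nat_eq_0_iff) simp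
  ultimately have "quad_gauss_sum p * cnj (quad_gauss_sum p) = of_nat p"
    by (metis mult_cancel_left)
  then have "complex_of_real ((norm (quad_gauss_sum p))\<^sup>2) = complex_of_real (real p)"
    by (simp only: complex_norm_square of_real_of_nat_eq)
  then show ?thesis by (simp only: of_real_eq_iff)
qed

end

section \<open>Fekete polynomials near the unit circle\<close>

definition geom_poly :: "nat \<Rightarrow> complex \<Rightarrow> complex" where
  "geom_poly p u = (\<Sum>n<p. u ^ n)"

lemma Re_inverse_one_minus_pos:
  fixes u :: complex
  assumes "norm u < 1"
  shows "Re (1 / (1 - u)) > 0"
proof -
  have "Re u < 1" using assms complex_Re_le_cmod[of u] by linarith
  moreover then have "1 - u \<noteq> 0" by auto
  ultimately show ?thesis by (simp add: Re_divide zero_less_divide_iff sum_power2_gt_zero_iff)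
qed

text \<open>The finite sum is \<open>1 / (1 - u)\<close>, which has positive real part in the unit
  disc, minus a tail \<open>u ^ p / (1 - u)\<close> whose modulus is estimated.\<close>

lemma Re_geom_poly_ge:
  assumes "norm u < 1"
  shows "Re (geom_poly p u) \<ge> - (norm u ^ p / (1 - norm u))"
proof -
  have u1: "u \<noteq> 1" using assms by auto
  have "geom_poly p u = 1 / (1 - u) - u ^ p / (1 - u)"
    using u1 unfolding geom_poly_def by (subst geometric_sum[OF u1]) (simp add: field_simps)
  moreover have "Re (u ^ p / (1 - u)) \<le> norm u ^ p / (1 - norm u)"
  proof -
    have "Re (u ^ p / (1 - u)) \<le> norm (u ^ p / (1 - u))" by (rule complex_Re_le_cmod)
    also have "\<dots> = norm u ^ p / norm (1 - u)" by (simp add: norm_divide norm_power)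
    also have "\<dots> \<le> norm u ^ p / (1 - norm u)"
      using assms norm_triangle_ineq2[of 1 u] u1 by (intro divide_left_mono mult_pos_pos) auto
    finally show ?thesis .
  qed
  ultimately show ?thesis using Re_inverse_one_minus_pos[OF assms] by simp
qed

section \<open>Fekete polynomials as complex polynomials, and their reflection\<close>

lemma coeff_fekete_poly: "coeff (fekete_poly p) n = (if n < p then Legendre (int n) (int p) else 0)"
  by (simp add: fekete_poly_def coeff_sum if_distrib cong: if_cong)

definition fekete_cpoly :: "nat \<Rightarrow> complex poly" where
  "fekete_cpoly p = map_poly of_int (fekete_poly p)"

lemma coeff_fekete_cpoly:
  "coeff (fekete_cpoly p) n = (if n < p then of_int (Legendre (int n) (int p)) else 0)"
  by (simp add: fekete_cpoly_def coeff_map_poly coeff_fekete_poly)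

lemma degree_fekete_cpoly: "p > 0 \<Longrightarrow> degree (fekete_cpoly p) < p"
  by (rule degree_lessI) (auto simp: coeff_fekete_cpoly)

lemma poly_fekete_cpoly:
  "poly (fekete_cpoly p) z = (\<Sum>n<p. of_int (Legendre (int n) (int p)) * z ^ n)"
proof -
  have "fekete_cpoly p = (\<Sum>n<p. monom (of_int (Legendre (int n) (int p))) n)"
    by (rule poly_eqI) (simp add: coeff_sum coeff_fekete_cpoly if_distrib cong: if_cong)
  then show ?thesis by (simp add: poly_sum poly_monom)
qed

lemma cnj_poly_fekete_cpoly: "cnj (poly (fekete_cpoly p) z) = poly (fekete_cpoly p) (cnj z)"
  by (simp add: poly_fekete_cpoly)

lemma sum_unity_char_int:
  assumes "p > 0"
  shows "(\<Sum>a\<in>{0..<int p}. unity_char p (n * a)) = (if int p dvd n then of_nat p else 0)"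
proof -
  have "(\<Sum>a\<in>{0..<int p}. unity_char p (n * a)) = (\<Sum>a<p. unity_char p (n * int a))"
    by (rule sum.reindex_bij_witness[of _ int nat]) auto
  then show ?thesis using sum_unity_char[OF assms] by simp
qed

lemma sum_geom_poly:
  assumes "p > 0"
  shows "(\<Sum>a\<in>{0..<int p}. geom_poly p (unity_char p a * z)) = of_nat p"
proof -
  have "(\<Sum>a\<in>{0..<int p}. geom_poly p (unity_char p a * z))
      = (\<Sum>n<p. z ^ n * (\<Sum>a\<in>{0..<int p}. unity_char p (int n * a)))"
    unfolding geom_poly_def
    by (subst sum.swap) (simp add: sum_distrib_left power_mult_distrib mult_ac flip: unity_char_mult_nat)
  also have "\<dots> = (\<Sum>n<p. if n = 0 then of_nat p else 0)"
    by (intro sum.cong refl) (use assms in \<open>auto simp: sum_unity_char_int dest: dvd_imp_le\<close>)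
  finally show ?thesis using assms by simp
qed

text \<open>With \<open>D\<close> the geometric sum, \<open>\<tau> F(z)\<close> is the sum of \<open>\<chi>(a) D(\<zeta>\<^sup>a z)\<close>. Adding the reflected term leaves
  only \<open>2 Re D(\<zeta>\<^sup>a z)\<close>, which is almost nonnegative, so the sum of the absolute values is about
  \<open>2 \<Sum>Re D = 2p\<close>, without the usual logarithm.\<close>

lemma fekete_reflection:
  fixes z :: complex
  assumes p: "prime p" "2 < p" and z: "norm z < 1" "norm z ^ p / (1 - norm z) \<le> 1/2"
  shows "norm (poly (fekete_cpoly p) z + of_int (Legendre (-1) p) * cnj (poly (fekete_cpoly p) z)) \<le> 4 * sqrt p"
proof -
  let ?I = "{0..<int p}" and ?tau = "quad_gauss_sum p"
  let ?chi = "\<lambda>a. of_int (Legendre a (int p)) :: complex"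
  have tw: "?chi (int n) * ?tau = (\<Sum>a\<in>?I. ?chi a * unity_char p (a * int n))" for n
    using gauss_sum_twist[OF p, of "int n"] by (simp only: mult.commute[of _ "int n"])
  have F: "?tau * poly (fekete_cpoly p) w = (\<Sum>a\<in>?I. ?chi a * geom_poly p (unity_char p a * w))" for w
  proof -
    have "?tau * poly (fekete_cpoly p) w = (\<Sum>n<p. (?chi (int n) * ?tau) * w ^ n)"
      by (simp add: poly_fekete_cpoly sum_distrib_left mult_ac)
    also have "\<dots> = (\<Sum>n<p. \<Sum>a\<in>?I. ?chi a * unity_char p (a * int n) * w ^ n)"
      by (simp only: tw sum_distrib_right)
    also have "\<dots> = (\<Sum>a\<in>?I. ?chi a * geom_poly p (unity_char p a * w))"
      by (subst sum.swap) (simp add: geom_poly_def sum_distrib_left unity_char_mult_nat power_mult_distrib mult_ac)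
    finally show ?thesis .
  qed
  \<comment> \<open>At \<open>cnj z\<close>, the factor \<open>?chi (-1)\<close> is absorbed by the
    substitution of \<open>-a\<close> for \<open>a\<close>. This conjugates the character, so the
    whole geometric sum becomes the conjugate of the one at \<open>z\<close>.\<close>
  have "?tau * (?chi (-1) * poly (fekete_cpoly p) (cnj z))
      = ?chi (-1) * (\<Sum>a\<in>?I. ?chi a * geom_poly p (unity_char p a * cnj z))"
    unfolding F[symmetric] by (simp only: mult.left_commute)
  also have "\<dots> = (\<Sum>a\<in>?I. ?chi (-1 * a) * geom_poly p (unity_char p a * cnj z))"
    by (simp only: Legendre_mult[OF p] sum_distrib_left of_int_mult mult.assoc)
  also have "\<dots> = (\<Sum>a\<in>?I. ?chi (-1 * a) * geom_poly p (unity_char p (- (-1 * a)) * cnj z))"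
    by simp
  also have "\<dots> = (\<Sum>a\<in>?I. ?chi a * geom_poly p (unity_char p (- a) * cnj z))"
  proof (rule sum_residues_mult[where f = "\<lambda>a. ?chi a * geom_poly p (unity_char p (- a) * cnj z)"])
    fix a b assume "[a = b] (mod int p)"
    then show "?chi a * geom_poly p (unity_char p (- a) * cnj z) = ?chi b * geom_poly p (unity_char p (- b) * cnj z)"
      using Legendre_cong[of a b p] unity_char_cong[of p a b] p(2) by (simp add: unity_char_minus)
  qed (use p in auto)
  also have "\<dots> = (\<Sum>a\<in>?I. ?chi a * cnj (geom_poly p (unity_char p a * z)))"
    by (simp add: geom_poly_def unity_char_minus)
  finally have G: "?tau * (?chi (-1) * poly (fekete_cpoly p) (cnj z))
      = (\<Sum>a\<in>?I. ?chi a * cnj (geom_poly p (unity_char p a * z)))" .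
  have "?tau * (poly (fekete_cpoly p) z + ?chi (-1) * poly (fekete_cpoly p) (cnj z))
      = (\<Sum>a\<in>?I. ?chi a * of_real (2 * Re (geom_poly p (unity_char p a * z))))"
    unfolding distrib_left F G by (simp only: complex_add_cnj[symmetric] distrib_left sum.distrib)
  then have "norm ?tau * norm (poly (fekete_cpoly p) z + ?chi (-1) * poly (fekete_cpoly p) (cnj z))
      = norm (\<Sum>a\<in>?I. ?chi a * of_real (2 * Re (geom_poly p (unity_char p a * z))))"
    by (metis norm_mult)
  \<comment> \<open>A real \<open>x\<close> with \<open>x >= -1/2\<close> satisfies
    \<open>|2x| <= 2x + 2\<close>. The absolute value is thus traded for a linear expression that
    can be summed exactly: \<open>2p + 2p = 4p\<close>.\<close>
  also have "\<dots> \<le> (\<Sum>a\<in>?I. 2 * Re (geom_poly p (unity_char p a * z)) + 2)"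
  proof (rule sum_norm_le)
    fix a
    have "norm (?chi a) \<le> 1" using Legendre_values[of a p] by auto
    moreover have "Re (geom_poly p (unity_char p a * z)) \<ge> - (1/2)"
    proof -
      have "Re (geom_poly p (unity_char p a * z)) \<ge> - (norm z ^ p / (1 - norm z))"
        using Re_geom_poly_ge[of "unity_char p a * z" p] z(1) by (simp add: norm_mult)
      then show ?thesis using z(2) by linarith
    qed
    then have "\<bar>2 * Re (geom_poly p (unity_char p a * z))\<bar> \<le> 2 * Re (geom_poly p (unity_char p a * z)) + 2"
      by linarith
    ultimately show "norm (?chi a * of_real (2 * Re (geom_poly p (unity_char p a * z)))) \<le> 2 * Re (geom_poly p (unity_char p a * z)) + 2"
      unfolding norm_mult norm_of_real
      using mult_right_mono[of "norm (?chi a)" 1 "\<bar>2 * Re (geom_poly p (unity_char p a * z))\<bar>"] by linarith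
  qed
  also have "\<dots> = 2 * Re (\<Sum>a\<in>?I. geom_poly p (unity_char p a * z)) + 2 * p"
    by (simp add: sum.distrib sum_distrib_left)
  also have "\<dots> = 4 * p" using p by (simp add: sum_geom_poly)
  finally have "norm ?tau * norm (poly (fekete_cpoly p) z + ?chi (-1) * poly (fekete_cpoly p) (cnj z)) \<le> 4 * p" .
  moreover have "norm ?tau = sqrt p"
    using norm_quad_gauss_sum[OF p] by (metis norm_ge_zero real_sqrt_unique)
  ultimately have "sqrt p * norm (poly (fekete_cpoly p) z + ?chi (-1) * poly (fekete_cpoly p) (cnj z)) \<le> sqrt p * (4 * sqrt p)"
    by (simp only: mult.left_commute[of "sqrt p" 4] flip: real_sqrt_mult) simp
  moreover have "sqrt p > 0" using p(2) by simp
  ultimately have "norm (poly (fekete_cpoly p) z + ?chi (-1) * poly (fekete_cpoly p) (cnj z)) \<le> 4 * sqrt p"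
    by (rule mult_left_le_imp_le)
  then show ?thesis by (simp only: cnj_poly_fekete_cpoly)
qed

text \<open>As \<open>Legendre (-1) p\<close> is 1 or -1, the reflection bound concerns the sum or
  the difference of \<open>F(z)\<close> and its conjugate, that is, twice the real or twice the
  imaginary part.\<close>

lemma fekete_strip:
  fixes z :: complex
  assumes p: "prime p" "2 < p" and z: "norm z < 1" "norm z ^ p / (1 - norm z) \<le> 1/2"
  shows "if Legendre (-1) p = 1 then \<bar>Re (poly (fekete_cpoly p) z)\<bar> \<le> 2 * sqrt p
         else \<bar>Im (poly (fekete_cpoly p) z)\<bar> \<le> 2 * sqrt p"
proof -
  let ?w = "poly (fekete_cpoly p) z"
  have "Legendre (-1) p \<noteq> 0"
    using Legendre_square_eq_1[OF p, of "-1"] by (metis coprime_minus_left_iff coprime_1_left mult_zero_left zero_neq_one)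
  then consider "Legendre (-1) p = 1" | "Legendre (-1) p = -1"
    using Legendre_values[of "-1" p] by blast
  then show ?thesis
  proof cases
    case 1
    have "norm (?w + cnj ?w) \<le> 4 * sqrt p"
      using fekete_reflection[OF assms] unfolding 1 by (simp only: of_int_1 mult_1_left)
    then have "\<bar>2 * Re ?w\<bar> \<le> 4 * sqrt p"
      by (simp only: complex_add_cnj norm_of_real)
    then have "\<bar>Re ?w\<bar> \<le> 2 * sqrt p" by linarith
    then show ?thesis using 1 by presburger
  next
    case 2
    have "norm (?w - cnj ?w) \<le> 4 * sqrt p"
      using fekete_reflection[OF assms] unfolding 2
      by (simp only: of_int_minus of_int_1 mult_minus1 diff_conv_add_uminus)
    then have "\<bar>2 * Im ?w\<bar> \<le> 4 * sqrt p"
      by (simp only: complex_diff_cnj norm_of_real norm_mult norm_ii mult_1_right)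
    then have "\<bar>Im ?w\<bar> \<le> 2 * sqrt p" by linarith
    then show ?thesis using 2 by presburger
  qed
qed

section \<open>Means over roots of unity\<close>

text \<open>Averages over these sample points replace integrals over circles. For
  \<open>K = 0\<close> the set is the whole plane, which explains the positivity assumptions on
  \<open>K\<close>.\<close>

abbreviation unity_roots :: "nat \<Rightarrow> complex set" where
  "unity_roots K \<equiv> {z. z ^ K = 1}"

lemma norm_unity_root:
  assumes "K > 0" "z \<in> unity_roots K"
  shows "norm z = 1"
  using assms power_eq_1_iff[of z K] by auto

lemma sum_unity_roots_power:
  assumes "K > 0"
  shows "(\<Sum>z\<in>unity_roots K. z ^ n) = (if K dvd n then of_nat K else 0)"
proof -
  have "(\<Sum>z\<in>unity_roots K. z ^ n) = (\<Sum>k<K. cis (2 * pi * real k / real K) ^ n)"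
    using assms by (intro sum.reindex_bij_betw[symmetric] bij_betw_roots_unity)
  also have "\<dots> = (\<Sum>k<K. unity_char K (int n * int k))"
    by (intro sum.cong refl) (simp add: unity_char_def DeMoivre mult_ac)
  finally show ?thesis using sum_unity_char[OF assms, of "int n"] by simp
qed

lemma sum_poly_unity_roots:
  fixes P :: "complex poly"
  assumes "degree P < K"
  shows "(\<Sum>z\<in>unity_roots K. poly P (r * z)) = of_nat K * coeff P 0"
proof -
  have "(\<Sum>z\<in>unity_roots K. poly P (r * z)) = (\<Sum>n\<le>degree P. coeff P n * r ^ n * (\<Sum>z\<in>unity_roots K. z ^ n))"
    by (simp add: poly_altdef power_mult_distrib sum_distrib_left mult_ac sum.swap[of _ "{..degree P}"])
  also have "\<dots> = (\<Sum>n\<le>degree P. if n = 0 then of_nat K * coeff P 0 else 0)"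
    using assms by (intro sum.cong refl) (auto simp: sum_unity_roots_power dest: dvd_imp_le)
  finally show ?thesis by simp
qed

text \<open>Discrete Parseval identity. Exponents below \<open>K\<close> are pairwise incongruent
  modulo \<open>K\<close>, so all cross terms vanish.\<close>

lemma sum_norm_square_unity_roots:
  fixes P :: "complex poly" and r :: real
  assumes "degree P < K"
  shows "(\<Sum>z\<in>unity_roots K. (norm (poly P (r * z)))\<^sup>2) = real K * (\<Sum>n\<le>degree P. (norm (coeff P n))\<^sup>2 * r ^ (2 * n))"
proof -
  have K: "K > 0" using assms by simp
  have orth: "(\<Sum>z\<in>unity_roots K. z ^ m * cnj z ^ n) = (if m = n then of_nat K else 0)"
    if "m < K" "n < K" for m n
  proof -
    \<comment> \<open>On the roots of unity conjugation is inversion. The exponent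
      \<open>K - n\<close> keeps everything in nonnegative powers, and \<open>m + (K - n)\<close>
      lies strictly between 0 and \<open>2 * K\<close>.\<close>
    have "z ^ m * cnj z ^ n = z ^ (m + (K - n))" if z: "z \<in> unity_roots K" for z
    proof -
      have "cnj z * z = 1" using norm_unity_root[OF K z] by (simp add: complex_norm_square[symmetric] mult.commute)
      then have "cnj z ^ n * z ^ n = 1" by (metis power_mult_distrib power_one)
      moreover have "z ^ (m + (K - n)) * z ^ n = z ^ m"
        using z \<open>n < K\<close> by (simp flip: power_add) (simp add: power_add)
      ultimately have "z ^ (m + (K - n)) * z ^ n = z ^ m * cnj z ^ n * z ^ n" 
        by (simp add: mult.assoc)
      moreover have "z ^ n \<noteq> 0" using z K by (auto simp: power_0_left)
      ultimately show ?thesis by (metis mult_right_cancel)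
    qed
    then have "(\<Sum>z\<in>unity_roots K. z ^ m * cnj z ^ n) = (\<Sum>z\<in>unity_roots K. z ^ (m + (K - n)))"
      by (intro sum.cong) auto
    moreover have "K dvd m + (K - n) \<longleftrightarrow> m = n"
    proof
      assume "K dvd m + (K - n)"
      then obtain c where c: "m + (K - n) = K * c" by auto
      have "0 < K * c" "K * c < K * 2" using c that by linarith+
      then have "c = 1" by auto
      then show "m = n" using c that by simp
    qed (use that in auto)
    ultimately show ?thesis using sum_unity_roots_power[OF K] by simp
  qed
  have "complex_of_real (\<Sum>z\<in>unity_roots K. (norm (poly P (r * z)))\<^sup>2)
     = (\<Sum>z\<in>unity_roots K. poly P (r * z) * cnj (poly P (r * z)))"
    by (simp only: of_real_sum complex_norm_square)
  also have "\<dots> = (\<Sum>z\<in>unity_roots K. \<Sum>m\<le>degree P. \<Sum>n\<le>degree P.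
       coeff P m * cnj (coeff P n) * of_real r ^ (m + n) * (z ^ m * cnj z ^ n))"
    by (simp add: poly_altdef sum_product power_mult_distrib power_add mult_ac)
  also have "\<dots> = (\<Sum>m\<le>degree P. \<Sum>n\<le>degree P. \<Sum>z\<in>unity_roots K.
       coeff P m * cnj (coeff P n) * of_real r ^ (m + n) * (z ^ m * cnj z ^ n))"
    by (subst sum.swap, intro sum.cong refl, subst sum.swap, simp)
  also have "\<dots> = (\<Sum>m\<le>degree P. \<Sum>n\<le>degree P. 
       coeff P m * cnj (coeff P n) * of_real r ^ (m + n) * (if m = n then of_nat K else 0))"
    by (intro sum.cong refl) (use assms in \<open>simp add: orth flip: sum_distrib_left\<close>)
  also have "\<dots> = (\<Sum>m\<le>degree P. coeff P m * cnj (coeff P m) * of_real r ^ (m + m) * of_nat K)"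
    by (intro sum.cong refl) (simp add: if_distrib cong: if_cong)
  also have "\<dots> = (\<Sum>m\<le>degree P. complex_of_real (real K * ((norm (coeff P m))\<^sup>2 * r ^ (2 * m))))"
  proof (intro sum.cong refl)
    fix m
    have "coeff P m * cnj (coeff P m) = complex_of_real ((norm (coeff P m))\<^sup>2)"
      by (simp only: complex_norm_square)
    then show "coeff P m * cnj (coeff P m) * of_real r ^ (m + m) * of_nat K
      = complex_of_real (real K * ((norm (coeff P m))\<^sup>2 * r ^ (2 * m)))"
      by (simp add: mult_2)
  qed
  also have "\<dots> = complex_of_real (real K * (\<Sum>n\<le>degree P. (norm (coeff P n))\<^sup>2 * r ^ (2 * n)))"
    by (simp only: of_real_sum[symmetric] sum_distrib_left)
  finally show ?thesis by (simp only: of_real_eq_iff)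
qed

text \<open>For \<open>y\<close> nonzero this is the homogenised factorisation of
  \<open>X^K - 1\<close>, whose roots are simple because its derivative vanishes only at 0.\<close>

lemma prod_unity_roots:
  assumes "K > 0"
  shows "(\<Prod>z\<in>unity_roots K. x - y * z) = x ^ K - y ^ K"
proof (cases "y = 0")
  case True
  then show ?thesis using assms by (simp add: card_roots_unity_eq)
next
  case False
  define p :: "complex poly" where "p = monom 1 K - 1"
  have lc: "lead_coeff p = 1"
  proof -
    have "degree p = K" unfolding p_def diff_conv_add_uminus 
      using assms by (subst degree_add_eq_left) (auto simp: degree_monom_eq)
    then show ?thesis using assms by (simp add: p_def)
  qed
  have "rsquarefree p"
    using assms by (auto simp: rsquarefree_roots p_def pderiv_diff pderiv_monom poly_monom power_0_left)
  from complex_poly_decompose_rsquarefree[OF this] have "(\<Prod>z|poly p z = 0. [:-z, 1:]) = p"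
    by (simp add: lc)
  then have "poly p (x / y) = poly (\<Prod>z|poly p z = 0. [:-z, 1:]) (x / y)" by simp
  also have "\<dots> = (\<Prod>z\<in>unity_roots K. x / y - z)"
    by (simp add: poly_prod p_def poly_monom)
  finally have "(\<Prod>z\<in>unity_roots K. x / y - z) = (x / y) ^ K - 1"
    by (simp add: p_def poly_monom)
  then have "(\<Prod>z\<in>unity_roots K. y * (x / y - z)) = y ^ K * ((x / y) ^ K - 1)"
    using assms by (simp add: prod.distrib card_roots_unity_eq)
  also have "\<dots> = x ^ K - y ^ K" using False by (simp add: field_simps)
  also have "(\<Prod>z\<in>unity_roots K. y * (x / y - z)) = (\<Prod>z\<in>unity_roots K. x - y * z)"
    using False by (intro prod.cong refl) (simp add: field_simps)
  finally show ?thesis .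
qed

lemma sum_ln_unity_roots:
  assumes "K > 0" "x ^ K \<noteq> y ^ K"
  shows "(\<Sum>z\<in>unity_roots K. ln (norm (x - y * z))) = ln (norm (x ^ K - y ^ K))"
proof -
  have fin: "finite (unity_roots K)" using assms by (simp add: finite_roots_unity)
  have nz: "x - y * z \<noteq> 0" if "z \<in> unity_roots K" for z
    using that assms(2) by (auto simp: power_mult_distrib)
  have "ln (norm (x ^ K - y ^ K)) = ln (\<Prod>z\<in>unity_roots K. norm (x - y * z))"
    using prod_unity_roots[OF assms(1), of x y] by (simp add: prod_norm)
  also have "\<dots> = (\<Sum>z\<in>unity_roots K. ln (norm (x - y * z)))"
    using nz fin by (intro ln_prod) auto
  finally show ?thesis by simp
qed

text \<open>Both powers are at most the \<open>K\<close>-th power of the larger modulus, so the loss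
  is \<open>ln 2\<close>, whatever \<open>K\<close> is.\<close>

lemma ln_norm_power_diff_le:
  fixes x y :: complex
  assumes "x ^ K \<noteq> y ^ K"
  shows "ln (norm (x ^ K - y ^ K)) \<le> real K * ln (max (norm x) (norm y)) + ln 2"
proof (cases "K = 0")
  case False
  let ?m = "max (norm x) (norm y)"
  have m: "?m > 0" using assms False by (auto simp: less_max_iff_disj)
  have "norm (x ^ K - y ^ K) \<le> norm x ^ K + norm y ^ K"
    by (metis norm_power norm_triangle_ineq4)
  also have "\<dots> \<le> ?m ^ K + ?m ^ K" by (intro add_mono power_mono) auto
  finally have "ln (norm (x ^ K - y ^ K)) \<le> ln (?m ^ K * 2)"
    using assms m by (subst ln_le_cancel_iff) auto
  also have "\<dots> = real K * ln ?m + ln 2" using m by (simp add: ln_mult ln_realpow)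
  finally show ?thesis .
qed (use assms in auto)

text \<open>When the moduli differ, the larger power eventually exceeds twice the smaller one. The
  loss is then at most \<open>ln 2\<close>, which is below \<open>K * e\<close> for large
  \<open>K\<close>.\<close>

lemma eventually_ln_norm_power_diff_ge:
  fixes x y :: complex
  assumes xy: "norm x \<noteq> norm y" and e: "e > 0"
  shows "\<forall>\<^sub>F K in sequentially. x ^ K \<noteq> y ^ K \<and>
    ln (norm (x ^ K - y ^ K)) \<ge> real K * (ln (max (norm x) (norm y)) - e)"
proof -
  have *: "\<forall>\<^sub>F K in sequentially. x ^ K \<noteq> y ^ K \<and>
    ln (norm (x ^ K - y ^ K)) \<ge> real K * (ln (norm y) - e)" if "norm x < norm y" for x y :: complex
  proof -
    have y: "norm y > 0" using that norm_ge_zero[of x] by linarith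
    have "(\<lambda>K. (norm x / norm y) ^ K) \<longlonglongrightarrow> 0"
      using that y by (intro LIMSEQ_realpow_zero) auto
    then have "\<forall>\<^sub>F K in sequentially. (norm x / norm y) ^ K < 1/2"
      by (rule order_tendstoD) simp
    moreover have "\<forall>\<^sub>F K in sequentially. real K \<ge> ln 2 / e"
      using real_arch_simple eventually_sequentiallyI[of "nat \<lceil>ln 2 / e\<rceil>"] by (metis nat_ceiling_le_eq)
    ultimately show ?thesis
    proof eventually_elim
      case (elim K)
      have "norm x ^ K < norm y ^ K / 2" using elim(1) y by (simp add: power_divide field_simps)
      moreover have "norm (x ^ K - y ^ K) \<ge> norm y ^ K - norm x ^ K"
        by (metis norm_minus_commute norm_power norm_triangle_ineq2)
      ultimately have ge: "norm (x ^ K - y ^ K) \<ge> norm y ^ K / 2" by linarith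
      have ypos: "norm y ^ K > 0" using y by simp
      have "real K * (ln (norm y) - e) \<le> real K * ln (norm y) - ln 2"
        using elim(2) e by (simp add: field_simps)
      also have "\<dots> = ln (norm y ^ K / 2)" using y by (simp add: ln_div ln_realpow)
      also have "\<dots> \<le> ln (norm (x ^ K - y ^ K))"
        using ge ypos by (subst ln_le_cancel_iff) linarith+
      finally have "real K * (ln (norm y) - e) \<le> ln (norm (x ^ K - y ^ K))" .
      moreover have "x ^ K \<noteq> y ^ K"
      proof
        assume "x ^ K = y ^ K"
        then have "norm y ^ K / 2 \<le> 0" using ge by simp
        then show False using ypos by linarith
      qed
      ultimately show ?case by simp
    qed
  qed
  show ?thesis
  proof (cases "norm x < norm y")
    case True
    then show ?thesis using *[of x y] by (simp add: max_def)
  next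
    case False
    then have "norm y < norm x" using xy by simp
    from *[OF this] show ?thesis using \<open>norm y < norm x\<close>
      by (simp add: max_def norm_minus_commute eq_commute)
  qed
qed

text \<open>M. Riesz's argument for \<open>L\<^sup>4\<close>: one bounded component controls the fourth moment, since the mean of
  \<open>Re f\<^sup>4\<close> vanishes.\<close>

lemma sum_norm_power4_le:
  fixes f :: "'a \<Rightarrow> complex"
  assumes s: "(\<Sum>x\<in>A. f x ^ 4) = 0"
    and B: "(\<forall>x\<in>A. \<bar>Re (f x)\<bar> \<le> B) \<or> (\<forall>x\<in>A. \<bar>Im (f x)\<bar> \<le> B)"
  shows "(\<Sum>x\<in>A. norm (f x) ^ 4) \<le> 8 * B\<^sup>2 * (\<Sum>x\<in>A. (norm (f x))\<^sup>2)"
proof -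
  have "norm (f x) ^ 4 \<le> Re (f x ^ 4) + 8 * B\<^sup>2 * (norm (f x))\<^sup>2" if x: "x \<in> A" for x
  proof -
    define a b where "a = Re (f x)" and "b = Im (f x)"
    have n: "(norm (f x))\<^sup>2 = a\<^sup>2 + b\<^sup>2" by (simp add: cmod_power2 a_def b_def)
    have "norm (f x) ^ 4 = (a\<^sup>2 + b\<^sup>2)\<^sup>2" unfolding n[symmetric] by simp
    moreover have "Re (f x ^ 4) = a ^ 4 - 6 * (a\<^sup>2 * b\<^sup>2) + b ^ 4"
      by (simp add: a_def b_def numeral_eq_Suc algebra_simps)
    ultimately have "norm (f x) ^ 4 = Re (f x ^ 4) + 8 * (a\<^sup>2 * b\<^sup>2)"
      by (simp add: power2_sum algebra_simps)
    moreover have "a\<^sup>2 * b\<^sup>2 \<le> B\<^sup>2 * (a\<^sup>2 + b\<^sup>2)"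
    proof -
      have "a\<^sup>2 \<le> B\<^sup>2 \<or> b\<^sup>2 \<le> B\<^sup>2"
        using B x unfolding a_def b_def by (metis abs_le_square_iff abs_ge_self order_trans)
      then show ?thesis
      proof
        assume "a\<^sup>2 \<le> B\<^sup>2"
        then have "a\<^sup>2 * b\<^sup>2 \<le> B\<^sup>2 * b\<^sup>2" by (intro mult_right_mono) auto
        then show ?thesis by (simp add: distrib_left add_increasing)
      next
        assume "b\<^sup>2 \<le> B\<^sup>2"
        then have "a\<^sup>2 * b\<^sup>2 \<le> a\<^sup>2 * B\<^sup>2" by (intro mult_left_mono) auto
        then show ?thesis by (simp add: distrib_left add_increasing2 mult.commute)
      qed
    qed
    ultimately show ?thesis using n by simp
  qed
  then have "(\<Sum>x\<in>A. norm (f x) ^ 4) \<le> (\<Sum>x\<in>A. Re (f x ^ 4) + 8 * B\<^sup>2 * (norm (f x))\<^sup>2)"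
    by (rule sum_mono)
  also have "\<dots> = Re (\<Sum>x\<in>A. f x ^ 4) + 8 * B\<^sup>2 * (\<Sum>x\<in>A. (norm (f x))\<^sup>2)"
    by (simp add: sum.distrib sum_distrib_left)
  finally show ?thesis using s by simp
qed

section \<open>Jensen's formula over roots of unity\<close>

text \<open>By Jensen's formula this is the mean of \<open>ln |P|\<close> over the circle of radius
  \<open>r\<close>. Writing it through the roots avoids integration.\<close>

definition log_mean :: "complex poly \<Rightarrow> real \<Rightarrow> real" where
  "log_mean P r = ln (norm (lead_coeff P)) + (\<Sum>a\<in>#proots P. ln (max (norm a) r))"

lemma ln_norm_prod_mset:
  fixes f :: "'a \<Rightarrow> complex"
  assumes "\<And>x. x \<in># A \<Longrightarrow> f x \<noteq> 0"
  shows "ln (norm (\<Prod>x\<in>#A. f x)) = (\<Sum>x\<in>#A. ln (norm (f x)))"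
  using assms
  by (induction A) (auto simp: norm_mult ln_mult prod_mset_zero_iff)

lemma ln_norm_poly:
  assumes "poly P z \<noteq> (0::complex)"
  shows "ln (norm (poly P z)) = ln (norm (lead_coeff P)) + (\<Sum>a\<in>#proots P. ln (norm (a - z)))"
proof -
  have P: "P \<noteq> 0" using assms by auto
  have nz: "z - a \<noteq> 0" if "a \<in># proots P" for a
    using that assms P by auto
  have "poly P z = poly (smult (lead_coeff P) (\<Prod>x\<in>#proots P. [:-x, 1:])) z"
    by (simp only: complex_poly_decompose_multiset)
  also have "\<dots> = lead_coeff P * (\<Prod>a\<in>#proots P. z - a)"
    by (simp add: poly_prod_mset)
  finally have "norm (poly P z) = norm (lead_coeff P) * norm (\<Prod>a\<in>#proots P. z - a)"
    by (metis norm_mult)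
  moreover have "norm (\<Prod>a\<in>#proots P. z - a) \<noteq> 0"
    using nz by (auto simp: prod_mset_zero_iff)
  ultimately have "ln (norm (poly P z)) = ln (norm (lead_coeff P)) + ln (norm (\<Prod>a\<in>#proots P. z - a))"
    using P by (simp add: ln_mult)
  then show ?thesis
    using nz by (simp add: ln_norm_prod_mset norm_minus_commute)
qed

lemma sum_sum_mset_swap:
  "(\<Sum>x\<in>A. \<Sum>a\<in>#M. f x a) = (\<Sum>a\<in>#M. \<Sum>x\<in>A. f x a :: real)"
  by (induction M) (auto simp: sum.distrib)

text \<open>Factoring \<open>P\<close> into linear factors and multiplying each factor over the
  sample points leaves a single logarithm per root.\<close>

lemma sum_ln_norm_poly:
  fixes r :: real
  assumes K: "K > 0" and nz: "\<And>z. z \<in> unity_roots K \<Longrightarrow> poly P (of_real r * z) \<noteq> 0"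
  shows "(\<Sum>z\<in>unity_roots K. ln (norm (poly P (of_real r * z))))
    = K * ln (norm (lead_coeff P)) + (\<Sum>a\<in>#proots P. ln (norm (a ^ K - of_real r ^ K)))"
    and "\<And>a. a \<in># proots P \<Longrightarrow> a ^ K \<noteq> of_real r ^ K"
proof -
  have P: "P \<noteq> 0"
    using nz[of 1] by auto
  show ne: "a ^ K \<noteq> of_real r ^ K" if a: "a \<in># proots P" for a
  proof
    assume eq: "a ^ K = of_real r ^ K"
    then have "(\<Prod>z\<in>unity_roots K. a - of_real r * z) = 0"
      by (simp add: prod_unity_roots[OF K])
    then obtain z where "z \<in> unity_roots K" "a = of_real r * z"
      using K by (auto simp: finite_roots_unity)
    then show False using a P nz by auto
  qed
  have "(\<Sum>z\<in>unity_roots K. ln (norm (poly P (of_real r * z))))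
    = (\<Sum>z\<in>unity_roots K. ln (norm (lead_coeff P)) + (\<Sum>a\<in>#proots P. ln (norm (a - r * z))))"
    using nz by (intro sum.cong refl ln_norm_poly) auto
  also have "\<dots> = K * ln (norm (lead_coeff P)) + (\<Sum>a\<in>#proots P. \<Sum>z\<in>unity_roots K. ln (norm (a - r * z)))"
    using K by (simp add: sum.distrib sum_sum_mset_swap card_roots_unity_eq)
  also have "(\<Sum>a\<in>#proots P. \<Sum>z\<in>unity_roots K. ln (norm (a - r * z)))
     = (\<Sum>a\<in>#proots P. ln (norm (a ^ K - of_real r ^ K)))"
    by (intro arg_cong[of _ _ sum_mset] image_mset_cong sum_ln_unity_roots K ne)
  finally show "(\<Sum>z\<in>unity_roots K. ln (norm (poly P (of_real r * z))))
    = K * ln (norm (lead_coeff P)) + (\<Sum>a\<in>#proots P. ln (norm (a ^ K - of_real r ^ K)))" .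
qed

lemma sum_ln_norm_poly_le:
  fixes r :: real
  assumes K: "K > 0" and r: "r > 0" and nz: "\<And>z. z \<in> unity_roots K \<Longrightarrow> poly P (of_real r * z) \<noteq> 0"
  shows "(\<Sum>z\<in>unity_roots K. ln (norm (poly P (of_real r * z)))) \<le> K * log_mean P r + degree P * ln 2"
proof -
  have "(\<Sum>a\<in>#proots P. ln (norm (a ^ K - of_real r ^ K))) \<le> (\<Sum>a\<in>#proots P. K * ln (max (norm a) r) + ln 2)"
    using ln_norm_power_diff_le[OF sum_ln_norm_poly(2)[OF K nz]] r by (intro sum_mset_mono) auto
  also have "\<dots> = K * (\<Sum>a\<in>#proots P. ln (max (norm a) r)) + degree P * ln 2"
    by (simp add: sum_mset.distrib sum_mset_distrib_left size_proots_complex)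
  finally show ?thesis
    using sum_ln_norm_poly(1)[OF K nz] unfolding log_mean_def by (simp add: distrib_left)
qed

text \<open>In contrast to the upper bound, which holds for every \<open>K\<close>, a root near the
  circle could make the sampled sum very small. So the circle must avoid the roots and
  \<open>K\<close> must be large in terms of \<open>P\<close>.\<close>

lemma eventually_sum_ln_norm_poly_ge:
  fixes r e :: real
  assumes P: "P \<noteq> 0" and r: "r > 0" and e: "e > 0" and nr: "\<And>a. a \<in># proots P \<Longrightarrow> norm a \<noteq> r"
  shows "\<forall>\<^sub>F K in sequentially. (\<forall>z\<in>unity_roots K. poly P (of_real r * z) \<noteq> 0) \<and>
    (\<Sum>z\<in>unity_roots K. ln (norm (poly P (of_real r * z)))) \<ge> K * (log_mean P r - e)"
proof -
  \<comment> \<open>The permitted loss is shared among the \<open>degree P\<close> roots; the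
    \<open>+ 1\<close> covers degree 0.\<close>
  define e' where "e' = e / (degree P + 1)"
  have e': "e' > 0" "degree P * e' \<le> e" using e by (auto simp: e'_def field_simps)
  have "\<forall>\<^sub>F K in sequentially. \<forall>a\<in>set_mset (proots P). a ^ K \<noteq> of_real r ^ K \<and>
    ln (norm (a ^ K - of_real r ^ K)) \<ge> real K * (ln (max (norm a) (norm (of_real r :: complex))) - e')"
    using nr r e' by (intro eventually_ball_finite ballI eventually_ln_norm_power_diff_ge) auto
  moreover have "\<forall>\<^sub>F K in sequentially. K > (0::nat)"
    by (rule eventually_gt_at_top)
  ultimately show ?thesis
  proof eventually_elim
    case (elim K)
    have nz: "poly P (of_real r * z) \<noteq> 0" if z: "z \<in> unity_roots K" for z
    proof
      assume "poly P (of_real r * z) = 0"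
      then have "r * z \<in># proots P" using P by simp
      then have "(r * z) ^ K \<noteq> of_real r ^ K" using elim by blast
      then show False using z by (simp add: power_mult_distrib)
    qed
    have "K * (\<Sum>a\<in>#proots P. ln (max (norm a) r)) - K * (degree P * e')
       = (\<Sum>a\<in>#proots P. K * (ln (max (norm a) r) - e'))"
    proof -
      have "K * (\<Sum>a\<in>#M. ln (max (norm a) r)) - K * (size M * e') = (\<Sum>a\<in>#M. K * (ln (max (norm a) r) - e'))"
        for M :: "complex multiset"
        by (induction M) (auto simp: algebra_simps)
      then show ?thesis by (metis size_proots_complex)
    qed
    also have "\<dots> \<le> (\<Sum>a\<in>#proots P. ln (norm (a ^ K - of_real r ^ K)))"
      using elim r by (intro sum_mset_mono) auto
    finally have "K * log_mean P r - K * (degree P * e') \<le> (\<Sum>z\<in>unity_roots K. ln (norm (poly P (of_real r * z))))"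
      using sum_ln_norm_poly(1)[OF elim(2) nz] unfolding log_mean_def by (simp add: distrib_left)
    moreover have "K * (degree P * e') \<le> K * e" using e' by (intro mult_left_mono) auto
    ultimately show ?case using nz by (auto simp: right_diff_distrib)
  qed
qed

text \<open>A root of modulus at least \<open>r1\<close> contributes the same to both means, any
  other root at most \<open>ln (r1 / r0)\<close> to the difference.\<close>

lemma log_mean_diff_le:
  assumes r: "0 < r0" "r0 < r1" and n: "size (filter_mset (\<lambda>a. norm a < r1) (proots P)) \<le> d"
  shows "log_mean P r1 - log_mean P r0 \<le> d * ln (r1 / r0)"
proof -
  have "ln (max (norm a) r1) - ln (max (norm a) r0) \<le> (if norm a < r1 then ln (r1 / r0) else 0)" for a :: complex
  proof (cases "norm a < r1")
    case True
    have "ln r0 \<le> ln (max (norm a) r0)" using r by (subst ln_le_cancel_iff) auto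
    then show ?thesis using True r by (simp add: ln_div max_absorb2)
  next
    case False
    then show ?thesis using r by (simp add: max_absorb1)
  qed
  then have "(\<Sum>a\<in>#proots P. ln (max (norm a) r1)) \<le> (\<Sum>a\<in>#proots P. ln (max (norm a) r0) + (if norm a < r1 then ln (r1 / r0) else 0))"
    by (intro sum_mset_mono) (simp add: algebra_simps)
  also have "\<dots> = (\<Sum>a\<in>#proots P. ln (max (norm a) r0)) + size (filter_mset (\<lambda>a. norm a < r1) (proots P)) * ln (r1 / r0)"
  proof -
    have "(\<Sum>a\<in>#M. (if norm a < r1 then ln (r1 / r0) else 0)) = size (filter_mset (\<lambda>a. norm a < r1) M) * ln (r1 / r0)" for M :: "complex multiset"
      by (induction M) (auto simp: algebra_simps)
    then show ?thesis by (simp add: sum_mset.distrib)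
  qed
  also have "\<dots> \<le> (\<Sum>a\<in>#proots P. ln (max (norm a) r0)) + d * ln (r1 / r0)"
    using n r by (intro add_left_mono mult_right_mono) auto
  finally show ?thesis by (simp add: log_mean_def)
qed

text \<open>Cartan's identity in discrete form: the mean of \<open>ln |F - w|\<close> over the circle \<open>|w| = R\<close> is
  \<open>ln max(|F|, R)\<close>, and each \<open>F - w\<close> has at most \<open>d\<close> zeros of modulus below \<open>r1\<close>. All means are over finitely
  many points; \<open>K1\<close>, the number \<open>M\<close> of values \<open>w\<close> per circle, \<open>r0\<close> and \<open>K0\<close> are chosen in this order, which
  keeps the logarithmic singularities under control.\<close>

lemma log_max_mean_increment:
  fixes F :: "complex poly" and Rs :: "real set" and r1 e :: real and K1 Kmin d :: nat
  assumes deg: "degree F > 0" and K1: "K1 > 0" and r: "0 < ra" "ra < rb" "rb \<le> r1"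
    and Rs: "finite Rs" "\<And>R. R \<in> Rs \<Longrightarrow> R > 0"
    and generic: "\<And>R z. R \<in> Rs \<Longrightarrow> z \<in> unity_roots K1 \<Longrightarrow> norm (poly F (of_real r1 * z)) \<noteq> R"
    and roots: "\<And>w. norm w \<in> Rs \<Longrightarrow> size (filter_mset (\<lambda>a. norm a < r1) (proots (F - [:w:]))) \<le> d"
    and e: "e > 0"
  obtains r0 K0 where "ra < r0" "r0 < rb" "K0 > Kmin"
    "\<And>R. R \<in> Rs \<Longrightarrow>
      (\<Sum>z\<in>unity_roots K1. ln (max (norm (poly F (of_real r1 * z))) R)) / K1
      \<le> (\<Sum>z\<in>unity_roots K0. ln (max (norm (poly F (of_real r0 * z))) R)) / K0
        + d * ln (r1 / r0) + degree F * ln 2 / K1 + e"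
proof -
  \<comment> \<open>Three losses will occur: averaging over \<open>w\<close> on the outer circle,
    sampling on the inner circle, and the term \<open>ln 2 / M\<close>.\<close>
  define e' where "e' = e / 3"
  have e': "e' > 0" using e by (simp add: e'_def)
  have F0: "F - [:w:] \<noteq> 0" for w using deg by auto
  have degw: "degree (F - [:w:]) = degree F" for w
    using deg unfolding diff_conv_add_uminus by (intro degree_add_eq_left) auto
  have finU: "finite (unity_roots K)" if "K > 0" for K using that by (simp add: finite_roots_unity)
  have r1: "r1 > 0" using r by simp

  \<comment> \<open>No sampled value on the outer circle has modulus \<open>R\<close>, so for large
    \<open>M\<close> the mean of \<open>ln |F - w|\<close> over the \<open>M\<close> points
    \<open>w\<close> with \<open>|w| = R\<close> nearly attains
    \<open>ln max(|F|, R)\<close>.\<close>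
  have generic': "norm (poly F (of_real r1 * z)) \<noteq> norm (of_real R :: complex)"
    if "R \<in> Rs" "z \<in> unity_roots K1" for R z
    using generic[OF that] Rs(2)[OF that(1)] by simp
  have "\<forall>\<^sub>F M in sequentially. \<forall>R\<in>Rs. \<forall>z\<in>unity_roots K1.
      poly F (of_real r1 * z) ^ M \<noteq> of_real R ^ M \<and>
      ln (norm (poly F (of_real r1 * z) ^ M - of_real R ^ M))
       \<ge> real M * (ln (max (norm (poly F (of_real r1 * z))) (norm (of_real R :: complex))) - e')"
    by (rule eventually_ball_finite[OF Rs(1)] ballI eventually_ball_finite[OF finU[OF K1]]
        eventually_ln_norm_power_diff_ge[OF generic' e'] | assumption)+
  moreover have "\<forall>\<^sub>F M in sequentially. real M \<ge> ln 2 / e'"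
    using eventually_sequentiallyI[of "nat \<lceil>ln 2 / e'\<rceil>"] by (metis nat_ceiling_le_eq)
  moreover have "\<forall>\<^sub>F M in sequentially. M > (0::nat)" by (rule eventually_gt_at_top)
  ultimately have "\<forall>\<^sub>F M in sequentially. M > 0 \<and> real M \<ge> ln 2 / e' \<and> (\<forall>R\<in>Rs. \<forall>z\<in>unity_roots K1.
      poly F (of_real r1 * z) ^ M \<noteq> of_real R ^ M \<and>
      ln (norm (poly F (of_real r1 * z) ^ M - of_real R ^ M))
       \<ge> real M * (ln (max (norm (poly F (of_real r1 * z))) (norm (of_real R :: complex))) - e'))"
    by eventually_elim auto
  from eventually_happens'[OF sequentially_bot this] obtain M where MM: "M > 0 \<and> real M \<ge> ln 2 / e' \<and> (\<forall>R\<in>Rs. \<forall>z\<in>unity_roots K1.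
      poly F (of_real r1 * z) ^ M \<noteq> of_real R ^ M \<and>
      ln (norm (poly F (of_real r1 * z) ^ M - of_real R ^ M))
       \<ge> real M * (ln (max (norm (poly F (of_real r1 * z))) (norm (of_real R :: complex))) - e'))" ..
  then have M: "M > 0" "real M \<ge> ln 2 / e'" by blast+
  have M1: "poly F (of_real r1 * z) ^ M \<noteq> of_real R ^ M"
    and M2: "ln (norm (poly F (of_real r1 * z) ^ M - of_real R ^ M))
       \<ge> real M * (ln (max (norm (poly F (of_real r1 * z))) R) - e')"
    if R: "R \<in> Rs" and z: "z \<in> unity_roots K1" for R z
  proof -
    have "norm (of_real R :: complex) = R" using Rs(2)[OF R] by simp
    then show "poly F (of_real r1 * z) ^ M \<noteq> of_real R ^ M"
      "ln (norm (poly F (of_real r1 * z) ^ M - of_real R ^ M))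
       \<ge> real M * (ln (max (norm (poly F (of_real r1 * z))) R) - e')"
      using MM R z by metis+
  qed

  define W where "W = (\<lambda>(R, y). of_real R * y) ` (Rs \<times> unity_roots M)"
  have finW: "finite W" unfolding W_def using Rs finU[OF M(1)] by (intro finite_imageI finite_cartesian_product)
  have normW: "norm w \<in> Rs" if w: "w \<in> W" for w
  proof -
    obtain R y where "R \<in> Rs" "y \<in> unity_roots M" "w = of_real R * y"
      using w by (auto simp: W_def)
    then show ?thesis using Rs(2)[of R] norm_unity_root[OF M(1), of y] by (simp add: norm_mult)
  qed

  \<comment> \<open>\<open>W\<close> is fixed and finite by now, so some radius in the interval
    misses the moduli of all roots of all \<open>F - w\<close>; only then can \<open>K0\<close> be
    chosen.\<close>
  have "finite (\<Union>w\<in>W. norm ` set_mset (proots (F - [:w:])))" using finW by auto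
  moreover have "infinite {ra<..<rb}" using r by simp
  ultimately obtain r0 where r0: "r0 \<in> {ra<..<rb}" "r0 \<notin> (\<Union>w\<in>W. norm ` set_mset (proots (F - [:w:])))"
    by (meson finite_subset subsetI)
  have r0': "r0 > 0" "r0 < r1" using r0 r by auto

  have "\<forall>\<^sub>F K in sequentially. \<forall>w\<in>W. (\<forall>z\<in>unity_roots K. poly (F - [:w:]) (of_real r0 * z) \<noteq> 0) \<and>
    (\<Sum>z\<in>unity_roots K. ln (norm (poly (F - [:w:]) (of_real r0 * z)))) \<ge> K * (log_mean (F - [:w:]) r0 - e')"
    using finW r0 r0' e' F0 by (intro eventually_ball_finite ballI eventually_sum_ln_norm_poly_ge) auto
  moreover have "\<forall>\<^sub>F K in sequentially. K > Kmin" by (rule eventually_gt_at_top)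
  ultimately have "\<forall>\<^sub>F K in sequentially. K > Kmin \<and> (\<forall>w\<in>W. (\<forall>z\<in>unity_roots K. poly (F - [:w:]) (of_real r0 * z) \<noteq> 0) \<and>
    (\<Sum>z\<in>unity_roots K. ln (norm (poly (F - [:w:]) (of_real r0 * z)))) \<ge> K * (log_mean (F - [:w:]) r0 - e'))"
    by eventually_elim auto
  from eventually_happens'[OF sequentially_bot this]
  obtain K0 where KK: "K0 > Kmin \<and> (\<forall>w\<in>W. (\<forall>z\<in>unity_roots K0. poly (F - [:w:]) (of_real r0 * z) \<noteq> 0) \<and>
    (\<Sum>z\<in>unity_roots K0. ln (norm (poly (F - [:w:]) (of_real r0 * z)))) \<ge> K0 * (log_mean (F - [:w:]) r0 - e'))" ..
  then have K0: "K0 > Kmin"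
    and K1': "\<And>w z. w \<in> W \<Longrightarrow> z \<in> unity_roots K0 \<Longrightarrow> poly (F - [:w:]) (of_real r0 * z) \<noteq> 0"
    and K2': "\<And>w. w \<in> W \<Longrightarrow> (\<Sum>z\<in>unity_roots K0. ln (norm (poly (F - [:w:]) (of_real r0 * z)))) \<ge> K0 * (log_mean (F - [:w:]) r0 - e')"
    by blast+
  have K0pos: "K0 > 0" using K0 by simp

  show thesis
  proof (rule that[of r0 K0])
    fix R assume R: "R \<in> Rs"
    have Rpos: "R > 0" using Rs(2) R .
    let ?U1 = "unity_roots K1" and ?U0 = "unity_roots K0" and ?UM = "unity_roots M"
    let ?S1 = "\<Sum>z\<in>?U1. ln (max (norm (poly F (of_real r1 * z))) R)"
    let ?S0 = "\<Sum>z\<in>?U0. ln (max (norm (poly F (of_real r0 * z))) R)"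
    have inW: "of_real R * y \<in> W" if "y \<in> ?UM" for y using that R by (auto simp: W_def)
    have nz1: "poly (F - [:of_real R * y:]) (of_real r1 * z) \<noteq> 0" if "y \<in> ?UM" "z \<in> ?U1" for y z
      using that M1[OF R that(2)] by (auto simp: power_mult_distrib)
    have ne0: "poly F (of_real r0 * z) ^ M \<noteq> of_real R ^ M" if z: "z \<in> ?U0" for z
    proof
      assume "poly F (of_real r0 * z) ^ M = of_real R ^ M"
      then have "(\<Prod>y\<in>?UM. poly F (of_real r0 * z) - of_real R * y) = 0"
        by (simp add: prod_unity_roots[OF M(1)])
      then obtain y where "y \<in> ?UM" "poly F (of_real r0 * z) = of_real R * y"
        using finU[OF M(1)] by auto
      then show False using K1'[OF inW z] by auto
    qed

    \<comment> \<open>On the outer circle the lower bound is used in the variable \<open>w\<close>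
      and the upper one in \<open>z\<close>; on the inner circle (\<open>lo\<close>) the roles are
      exchanged. In both, swapping the two sums turns averages over \<open>w\<close> into Jensen
      sums for \<open>F - w\<close>.\<close>
    have up: "real M * ?S1 - real M * real K1 * e' \<le> (\<Sum>y\<in>?UM. real K1 * log_mean (F - [:of_real R * y:]) r1) + real M * (degree F * ln 2)"
    proof -
      have "real M * ?S1 - real M * real K1 * e' = (\<Sum>z\<in>?U1. real M * (ln (max (norm (poly F (of_real r1 * z))) R) - e'))"
        using K1 by (simp add: sum_distrib_left sum_subtractf right_diff_distrib card_roots_unity_eq)
      also have "\<dots> \<le> (\<Sum>z\<in>?U1. ln (norm (poly F (of_real r1 * z) ^ M - of_real R ^ M)))"
        by (intro sum_mono M2 R)
      also have "\<dots> = (\<Sum>z\<in>?U1. \<Sum>y\<in>?UM. ln (norm (poly F (of_real r1 * z) - of_real R * y)))"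
        by (intro sum.cong refl sum_ln_unity_roots[symmetric] M(1) M1 R)
      also have "\<dots> = (\<Sum>y\<in>?UM. \<Sum>z\<in>?U1. ln (norm (poly (F - [:of_real R * y:]) (of_real r1 * z))))"
        by (subst sum.swap) simp
      also have "\<dots> \<le> (\<Sum>y\<in>?UM. real K1 * log_mean (F - [:of_real R * y:]) r1 + degree (F - [:of_real R * y:]) * ln 2)"
        by (intro sum_mono sum_ln_norm_poly_le K1 r1 nz1)
      also have "\<dots> = (\<Sum>y\<in>?UM. real K1 * log_mean (F - [:of_real R * y:]) r1) + real M * (degree F * ln 2)"
        using M(1) by (simp add: degw sum.distrib card_roots_unity_eq)
      finally show ?thesis .
    qed
    have lo: "(\<Sum>y\<in>?UM. real K0 * log_mean (F - [:of_real R * y:]) r0) - real M * real K0 * e' \<le> real M * ?S0 + real K0 * ln 2"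
    proof -
      have "(\<Sum>y\<in>?UM. real K0 * log_mean (F - [:of_real R * y:]) r0) - real M * real K0 * e'
         = (\<Sum>y\<in>?UM. real K0 * (log_mean (F - [:of_real R * y:]) r0 - e'))"
        using M(1) by (simp add: sum_subtractf right_diff_distrib card_roots_unity_eq)
      also have "\<dots> \<le> (\<Sum>y\<in>?UM. \<Sum>z\<in>?U0. ln (norm (poly (F - [:of_real R * y:]) (of_real r0 * z))))"
        by (intro sum_mono K2' inW)
      also have "\<dots> = (\<Sum>z\<in>?U0. \<Sum>y\<in>?UM. ln (norm (poly F (of_real r0 * z) - of_real R * y)))"
        by (subst sum.swap) simp
      also have "\<dots> = (\<Sum>z\<in>?U0. ln (norm (poly F (of_real r0 * z) ^ M - of_real R ^ M)))"
        by (intro sum.cong refl sum_ln_unity_roots M(1) ne0)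
      also have "\<dots> \<le> (\<Sum>z\<in>?U0. real M * ln (max (norm (poly F (of_real r0 * z))) (norm (of_real R :: complex))) + ln 2)"
        by (intro sum_mono ln_norm_power_diff_le ne0)
      also have "\<dots> = real M * ?S0 + real K0 * ln 2"
        using K0pos Rpos by (simp add: sum.distrib sum_distrib_left card_roots_unity_eq)
      finally show ?thesis .
    qed
    have inc: "(\<Sum>y\<in>?UM. log_mean (F - [:of_real R * y:]) r1) \<le> (\<Sum>y\<in>?UM. log_mean (F - [:of_real R * y:]) r0) + real M * (d * ln (r1 / r0))"
    proof -
      have "log_mean (F - [:of_real R * y:]) r1 \<le> log_mean (F - [:of_real R * y:]) r0 + d * ln (r1 / r0)" if "y \<in> ?UM" for y
        using log_mean_diff_le[OF r0' roots[OF normW[OF inW[OF that]]]] by simp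
      then have "(\<Sum>y\<in>?UM. log_mean (F - [:of_real R * y:]) r1) \<le> (\<Sum>y\<in>?UM. log_mean (F - [:of_real R * y:]) r0 + d * ln (r1 / r0))"
        by (intro sum_mono)
      then show ?thesis using M(1) by (simp add: sum.distrib card_roots_unity_eq)
    qed
    define A1 A0 where "A1 = (\<Sum>y\<in>?UM. log_mean (F - [:of_real R * y:]) r1) / M"
      and "A0 = (\<Sum>y\<in>?UM. log_mean (F - [:of_real R * y:]) r0) / M"
    have 1: "?S1 / K1 - e' \<le> A1 + degree F * ln 2 / K1"
      using divide_right_mono[OF up[folded sum_distrib_left], of "real M * real K1"] M(1) K1
      unfolding A1_def by (simp add: add_divide_distrib diff_divide_distrib)
    have 2: "A0 - e' \<le> ?S0 / K0 + ln 2 / M"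
      using divide_right_mono[OF lo[folded sum_distrib_left], of "real M * real K0"] M(1) K0pos
      unfolding A0_def by (simp add: add_divide_distrib diff_divide_distrib)
    have 3: "A1 \<le> A0 + d * ln (r1 / r0)"
      using inc M(1) unfolding A1_def A0_def by (simp add: field_simps)
    have 4: "ln 2 / M \<le> e'"
      using M e' by (simp add: field_simps)
    have "e = 3 * e'" by (simp add: e'_def)
    then show "?S1 / K1 \<le> ?S0 / K0 + d * ln (r1 / r0) + degree F * ln 2 / K1 + e"
      using 1 2 3 4 by linarith
  qed (use r0 K0 in auto)
qed

section \<open>Zeros of polynomials with a gap\<close>

lemma degree_div_linear:
  fixes T :: "complex poly"
  assumes "degree ([:-a, 1:] * T) \<le> L"
  shows "degree T \<le> L"
proof (cases "T = 0")
  case False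
  then show ?thesis using assms degree_mult_eq[of "[:-a, 1:]" T] by simp
qed simp

lemma coeff_linear_mult:
  fixes T :: "'a::comm_ring_1 poly"
  shows "coeff ([:-a, 1:] * T) (Suc n) = coeff T n - a * coeff T (Suc n)"
  by simp

text \<open>Dividing a polynomial by a linear factor expresses each coefficient of the quotient through
  the \<^emph>\<open>higher\<close> coefficients of the dividend, so that the decay survives the division.\<close>

lemma coeff_div_linear_bound:
  fixes T :: "complex poly" and r B :: real
  assumes a: "norm a \<le> r" and r: "0 \<le> r" "r \<le> 1" and B: "B \<ge> 0"
    and L: "degree ([:-a, 1:] * T) \<le> L"
    and S: "\<And>n. n \<ge> D \<Longrightarrow> norm (coeff ([:-a, 1:] * T) n) \<le> B * r ^ (N - n)"
    and n: "Suc n \<ge> D"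
  shows "norm (coeff T n) \<le> (B * L) * r ^ (N - Suc n)"
proof -
  \<comment> \<open>Downward induction along \<open>T_n = S_(n+1) + a T_(n+1)\<close>, with
    \<open>S\<close> the dividend; the factor \<open>L - n\<close> counts the coefficients of
    \<open>S\<close> that enter.\<close>
  have *: "norm (coeff T n) \<le> real (L - n) * B * r ^ (N - Suc n)" if "Suc n \<ge> D" "n \<le> L" for n
    using that(2,1)
  proof (induction n rule: inc_induct)
    case base
    have "coeff ([:-a, 1:] * T) (Suc L) = 0" using L by (intro coeff_eq_0) simp
    moreover have "coeff T (Suc L) = 0" using degree_div_linear[OF L] by (intro coeff_eq_0) simp
    ultimately show ?case using coeff_linear_mult[of a T L] by simp
  next
    case (step n)
    have "coeff T n = coeff ([:-a, 1:] * T) (Suc n) + a * coeff T (Suc n)"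
      by (simp add: coeff_linear_mult)
    then have "norm (coeff T n) \<le> norm (coeff ([:-a, 1:] * T) (Suc n)) + norm a * norm (coeff T (Suc n))"
      by (metis norm_mult norm_triangle_ineq)
    also have "\<dots> \<le> B * r ^ (N - Suc n) + r * (real (L - Suc n) * B * r ^ (N - Suc (Suc n)))"
      using S[of "Suc n"] step a r B by (intro add_mono mult_mono) auto
    also have "r * (real (L - Suc n) * B * r ^ (N - Suc (Suc n))) = real (L - Suc n) * B * r ^ Suc (N - Suc (Suc n))"
      by simp
    \<comment> \<open>Only an inequality, because subtraction is truncated: for
      \<open>Suc n >= N\<close> the exponents are 1 on the left and 0 on the right.\<close>
    also have "\<dots> \<le> real (L - Suc n) * B * r ^ (N - Suc n)"
      using r B by (intro mult_left_mono power_decreasing) auto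
    also have "B * r ^ (N - Suc n) + real (L - Suc n) * B * r ^ (N - Suc n) = real (L - n) * B * r ^ (N - Suc n)"
      using step(2) by (simp add: of_nat_diff algebra_simps)
    finally show ?case by simp
  qed
  show ?thesis
  proof (cases "n \<le> L")
    case True
    have "real (L - n) * B * r ^ (N - Suc n) \<le> real L * B * r ^ (N - Suc n)"
      using r B by (intro mult_right_mono) auto
    with *[OF n True] show ?thesis by (simp add: mult_ac)
  next
    case False
    then have "coeff T n = 0" using degree_div_linear[OF L] by (intro coeff_eq_0) simp
    then show ?thesis using r B by simp
  qed
qed

text \<open>Iterated division: each linear factor costs a factor \<open>L\<close> and lowers both
  the threshold \<open>E\<close> and the exponent by one.\<close>

lemma coeff_quotient_bound:
  fixes T :: "complex poly" and r B :: real
  assumes "\<And>a. a \<in># A \<Longrightarrow> norm a \<le> r" and r: "0 \<le> r" "r \<le> 1" and "B \<ge> 0"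
    and "degree ((\<Prod>a\<in>#A. [:-a, 1:]) * T) \<le> L"
    and "\<And>n. n \<ge> E \<Longrightarrow> norm (coeff ((\<Prod>a\<in>#A. [:-a, 1:]) * T) n) \<le> B * r ^ (N - n)"
    and "size A \<le> E" "n \<ge> E - size A"
  shows "norm (coeff T n) \<le> B * real L ^ size A * r ^ (N - (n + size A))"
  using assms(1,4-)
proof (induction A arbitrary: B N E n)
  case empty
  then show ?case by simp
next
  case (add x A)
  let ?S = "(\<Prod>a\<in>#A. [:-a, 1:]) * T"
  have eq: "(\<Prod>a\<in>#add_mset x A. [:-a, 1:]) * T = [:-x, 1:] * ?S" by (simp only: image_mset_add_mset prod_mset.add_mset mult.assoc)
  have deg: "degree ?S \<le> L"
    using add.prems(3) unfolding eq by (rule degree_div_linear)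
  have bnd: "norm (coeff ?S m) \<le> (B * real L) * r ^ ((N - 1) - m)" if "m \<ge> E - 1" for m
  proof -
    have "norm (coeff ?S m) \<le> (B * real L) * r ^ (N - Suc m)"
    proof (rule coeff_div_linear_bound)
      show "norm x \<le> r" using add.prems(1) by simp
      show "degree ([:-x, 1:] * ?S) \<le> L" using add.prems(3) unfolding eq .
      show "norm (coeff ([:-x, 1:] * ?S) k) \<le> B * r ^ (N - k)" if "k \<ge> E" for k
        using add.prems(4)[OF that] unfolding eq .
    qed (use r add.prems that in auto)
    then show ?thesis by simp
  qed
  have "norm (coeff T n) \<le> (B * real L) * real L ^ size A * r ^ ((N - 1) - (n + size A))"
  proof (rule add.IH[OF _ _ deg bnd])
    show "norm a \<le> r" if "a \<in># A" for a using add.prems(1) that by simp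
  qed (use add.prems in auto)
  then show ?case by (simp add: mult_ac)
qed

text \<open>Multiplying by \<open>X - a\<close> with \<open>|a| <= 1\<close> at most doubles a
  coefficient bound and never draws on higher coefficients, so control below \<open>D\<close> is
  preserved.\<close>

lemma coeff_mult_linear_factors_bound:
  fixes T :: "complex poly" and b :: real
  assumes "\<And>a. a \<in># A \<Longrightarrow> norm a \<le> 1" and T: "\<And>n. n < D \<Longrightarrow> norm (coeff T n) \<le> b" and "n < D"
  shows "norm (coeff ((\<Prod>a\<in>#A. [:-a, 1:]) * T) n) \<le> 2 ^ size A * b"
  using assms(1,3)
proof (induction A arbitrary: n)
  case empty
  then show ?case using T by simp
next
  case (add x A)
  let ?S = "(\<Prod>a\<in>#A. [:-a, 1:]) * T"
  have eq: "(\<Prod>a\<in>#add_mset x A. [:-a, 1:]) * T = [:-x, 1:] * ?S" by (simp only: image_mset_add_mset prod_mset.add_mset mult.assoc)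
  have S: "norm (coeff ?S m) \<le> 2 ^ size A * b" if "m < D" for m
    using add.IH[of m] add.prems that by simp
  have x: "norm x \<le> 1" using add.prems by simp
  have xS: "norm (x * coeff ?S m) \<le> 2 ^ size A * b" if "m < D" for m
    unfolding norm_mult using mult_left_le_one_le[of "norm (coeff ?S m)" "norm x"] x S[OF that] by simp
  have b0: "0 \<le> 2 ^ size A * b" using S[OF add.prems(2)] norm_ge_zero order_trans by blast
  show ?case
  proof (cases n)
    case 0
    have "coeff ([:-x, 1:] * ?S) 0 = - (x * coeff ?S 0)" by simp
    then show ?thesis using xS[of 0] add.prems(2) b0 0 unfolding eq by simp
  next
    case (Suc m)
    have "norm (coeff ([:-x, 1:] * ?S) (Suc m)) \<le> norm (coeff ?S m) + norm (x * coeff ?S (Suc m))"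
      unfolding coeff_linear_mult by (rule norm_triangle_ineq4)
    then show ?thesis using xS[of n] S[of m] add.prems(2) Suc unfolding eq by simp
  qed
qed

text \<open>Meant for a polynomial with a gap: low order terms below \<open>X\<^sup>D\<close>, where \<open>D\<close> is the size of \<open>A\<close>, and
  bounded terms from \<open>X\<^sup>N\<close> on. With \<open>D\<close> zeros in a disc of radius \<open>r < 1\<close>, its low order terms must be
  exponentially small.\<close>

lemma coeff_low_bound_of_roots:
  fixes T :: "complex poly" and r B :: real
  assumes A: "\<And>a. a \<in># A \<Longrightarrow> norm a \<le> r" and r: "0 \<le> r" "r \<le> 1" and B: "B \<ge> 0"
    and L: "degree ((\<Prod>a\<in>#A. [:-a, 1:]) * T) \<le> L"
    and S: "\<And>n. n \<ge> size A \<Longrightarrow> norm (coeff ((\<Prod>a\<in>#A. [:-a, 1:]) * T) n) \<le> B * r ^ (N - n)"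
    and n: "n < size A"
  shows "norm (coeff ((\<Prod>a\<in>#A. [:-a, 1:]) * T) n) \<le> 2 ^ size A * (B * real L ^ size A * r ^ (N - 2 * size A))"
proof (rule coeff_mult_linear_factors_bound[OF _ _ n])
  show "norm a \<le> 1" if "a \<in># A" for a using A[OF that] r by simp
next
  fix m assume m: "m < size A"
  \<comment> \<open>Dividing out \<open>size A\<close> factors moves the threshold from
    \<open>size A\<close> down to 0, so even the lowest coefficients of \<open>T\<close> are small;
    multiplying back transfers this to the product.\<close>
  have "norm (coeff T m) \<le> B * real L ^ size A * r ^ (N - (m + size A))"
    by (rule coeff_quotient_bound[OF A r B L S]) auto
  also have "\<dots> \<le> B * real L ^ size A * r ^ (N - 2 * size A)"
    using r B m by (intro mult_left_mono power_decreasing) auto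
  finally show "norm (coeff T m) \<le> B * real L ^ size A * r ^ (N - 2 * size A)" .
qed

section \<open>Substitution into a bivariate polynomial\<close>

lemma diff_dvd_poly_diff:
  fixes a b :: "'a::comm_ring_1"
  shows "a - b dvd poly q a - poly q b"
proof (induction q)
  case (pCons c q)
  have "poly (pCons c q) a - poly (pCons c q) b = (a - b) * poly q a + b * (poly q a - poly q b)"
    by (simp add: algebra_simps)
  then show ?case using pCons.IH by (metis dvd_add dvd_mult dvd_triv_left)
qed simp

lemma subst_fps_of_poly: "subst_fps h (fps_of_poly F) = fps_of_poly (poly h F)"
  unfolding subst_fps_def
  by (induction h) (simp_all add: map_poly_pCons fps_of_poly_add fps_of_poly_mult)

text \<open>\<open>F - G\<close> divides \<open>h(X, F) - h(X, G)\<close>, so a congruence modulo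
  \<open>X^N\<close> passes from \<open>F\<close> and \<open>G\<close> to \<open>h(X, F)\<close> and
  0.\<close>

lemma coeff_poly_eq_0_of_approx:
  assumes "fps_X ^ N dvd fps_of_poly F - G" "subst_fps h G = 0" "n < N"
  shows "coeff (poly h F) n = 0"
proof -
  have "fps_of_poly F - G dvd subst_fps h (fps_of_poly F) - subst_fps h G"
    unfolding subst_fps_def by (rule diff_dvd_poly_diff)
  then have "fps_X ^ N dvd fps_of_poly (poly h F)"
    using assms(1,2) by (auto simp: subst_fps_of_poly intro: dvd_trans)
  then obtain k where "fps_of_poly (poly h F) = fps_X ^ N * k" by (auto elim: dvdE)
  then have "fps_nth (fps_of_poly (poly h F)) n = 0"
    using assms(3) by (simp add: fps_X_power_mult_nth)
  then show ?thesis by simp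
qed

lemma norm_coeff_mult_le:
  fixes P Q :: "complex poly"
  assumes P: "\<And>n. norm (coeff P n) \<le> b" and Q: "\<And>n. norm (coeff Q n) \<le> 1" "\<And>n. n \<ge> m \<Longrightarrow> coeff Q n = 0"
  shows "norm (coeff (Q * P) n) \<le> real m * b"
proof -
  have b: "b \<ge> 0" using P[of 0] norm_ge_zero order_trans by blast
  have "norm (coeff (Q * P) n) \<le> (\<Sum>i\<le>n. norm (coeff Q i * coeff P (n - i)))"
    unfolding coeff_mult by (rule norm_sum)
  also have "\<dots> \<le> (\<Sum>i\<le>n. if i < m then b else 0)"
  proof (intro sum_mono)
    fix i show "norm (coeff Q i * coeff P (n - i)) \<le> (if i < m then b else 0)"
      using mult_mono[OF Q(1)[of i] P[of "n - i"]] Q(2)[of i] by (auto simp: norm_mult)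
  qed
  also have "\<dots> = (\<Sum>i\<in>{..n} \<inter> {..<m}. b)"
    by (simp add: sum.If_cases lessThan_def)
  also have "\<dots> \<le> real m * b"
    using b card_mono[of "{..<m}" "{..n} \<inter> {..<m}"] by (simp add: mult_right_mono)
  finally show ?thesis .
qed

text \<open>Multiplication by \<open>F\<close>, which has at most \<open>p\<close> terms, enlarges
  coefficients by at most a factor \<open>p\<close>. The square counts the powers of
  \<open>Y\<close> and the coefficients of each \<open>coeff h j\<close>.\<close>

lemma norm_coeff_subst_le:
  fixes F :: "complex poly" and h :: "complex poly poly"
  assumes F: "\<And>n. norm (coeff F n) \<le> 1" "degree F < p"
    and h: "degrees_le h d" "\<And>i j. norm (coeff (coeff h j) i) \<le> 1"
  shows "norm (coeff (poly h F) n) \<le> (real d + 1)\<^sup>2 * real p ^ d"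
    and "degree (poly h F) \<le> d * p"
proof -
  have pow: "norm (coeff (F ^ j) n) \<le> real p ^ j" for j n
  proof (induction j arbitrary: n)
    case (Suc j)
    show ?case using norm_coeff_mult_le[of "F ^ j" "real p ^ j" F p n] Suc F by (simp add: coeff_eq_0)
  qed simp
  have hd: "degree h \<le> d" "\<And>j. degree (coeff h j) \<le> d" using h(1) by (auto simp: degrees_le_def)
  have tm: "norm (coeff (coeff h j * F ^ j) n) \<le> real (d + 1) * real p ^ d" if "j \<le> degree h" for j
  proof -
    have "norm (coeff (coeff h j * F ^ j) n) \<le> real (d + 1) * real p ^ j"
      using hd(2)[of j] h(2) by (intro norm_coeff_mult_le pow) (auto intro!: coeff_eq_0)
    also have "\<dots> \<le> real (d + 1) * real p ^ d"
      using that hd(1) F(2) by (intro mult_left_mono power_increasing) auto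
    finally show ?thesis .
  qed
  have "norm (coeff (poly h F) n) \<le> (\<Sum>j\<le>degree h. norm (coeff (coeff h j * F ^ j) n))"
    unfolding poly_altdef coeff_sum by (rule norm_sum)
  also have "\<dots> \<le> (\<Sum>j\<le>degree h. real (d + 1) * real p ^ d)"
    by (intro sum_mono tm) auto
  also have "\<dots> \<le> real (d + 1) * (real (d + 1) * real p ^ d)"
    using hd(1) by (simp add: mult_right_mono)
  finally show "norm (coeff (poly h F) n) \<le> (real d + 1)\<^sup>2 * real p ^ d"
    by (simp add: power2_eq_square mult.assoc add.commute)
  show "degree (poly h F) \<le> d * p"
    unfolding poly_altdef
  proof (rule degree_sum_le)
    fix j assume j: "j \<in> {..degree h}"
    have "degree (coeff h j * F ^ j) \<le> degree (coeff h j) + degree (F ^ j)" by (rule degree_mult_le)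
    also have "\<dots> \<le> d + degree F * j" by (intro add_mono hd degree_power_le)
    also have "\<dots> \<le> d + (p - 1) * d" using j hd(1) F(2) by (intro add_mono mult_mono) auto
    also have "\<dots> = d * p" using F(2) by (cases p) auto
    finally show "degree (coeff h j * F ^ j) \<le> d * p" .
  qed simp
qed

section \<open>Lower bounds for a polynomial away from its roots\<close>

lemma norm_coeff_prod_linear_le:
  fixes A :: "complex multiset"
  shows "norm (coeff (\<Prod>a\<in>#A. [:-a, 1:]) n) \<le> (\<Prod>a\<in>#A. 1 + norm a)"
proof (induction A arbitrary: n)
  case empty
  then show ?case by simp
next
  case (add x A)
  let ?S = "\<Prod>a\<in>#A. [:-a, 1:]" and ?b = "\<Prod>a\<in>#A. 1 + norm a"
  have b: "?b \<ge> 0" using add[of 0] norm_ge_zero order_trans by blast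
  have xb: "norm (x * coeff ?S m) \<le> norm x * ?b" for m
    unfolding norm_mult by (intro mult_left_mono add) auto
  show ?case
  proof (cases n)
    case 0
    then have "coeff (\<Prod>a\<in>#add_mset x A. [:-a, 1:]) n = - (x * coeff ?S 0)" by simp
    then have "norm (coeff (\<Prod>a\<in>#add_mset x A. [:-a, 1:]) n) \<le> norm x * ?b"
      using xb[of 0] by (simp only: norm_minus_cancel)
    then show ?thesis using b by (simp add: distrib_right)
  next
    case (Suc m)
    then have "coeff (\<Prod>a\<in>#add_mset x A. [:-a, 1:]) n = coeff ?S m - x * coeff ?S (Suc m)"
      by (simp add: coeff_linear_mult del: mult_pCons_left)
    then have "norm (coeff (\<Prod>a\<in>#add_mset x A. [:-a, 1:]) n) \<le> norm (coeff ?S m) + norm (x * coeff ?S (Suc m))"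
      by (simp only: norm_triangle_ineq4)
    also have "\<dots> \<le> ?b + norm x * ?b" by (intro add_mono add xb)
    finally show ?thesis by (simp add: distrib_right)
  qed
qed

text \<open>A coefficient of modulus at least 1 forces \<open>|lead_coeff q|\<close> times the
  product of all \<open>1 + |a|\<close> to be at least 1. Each factor satisfies
  \<open>|w - a| >= k (1 + |a|)\<close>: by separation if \<open>|a| <= 2 |w|\<close>, and by
  \<open>k <= 1/4\<close> otherwise.\<close>

lemma norm_poly_ge_of_separated:
  fixes q :: "complex poly" and w :: complex and k \<delta> :: real
  assumes deg: "degree q \<le> d" and q: "norm (coeff q j) \<ge> 1"
    and sep: "\<And>a. a \<in># proots q \<Longrightarrow> \<bar>norm w - norm a\<bar> \<ge> \<delta>"
    and w: "norm w \<ge> 1" and k: "0 \<le> k" "k \<le> 1/4" "k * (1 + 2 * norm w) \<le> \<delta>"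
  shows "norm (poly q w) \<ge> k ^ d"
proof -
  have fac: "norm (w - a) \<ge> k * (1 + norm a)" if a: "a \<in># proots q" for a
  proof (cases "norm a \<le> 2 * norm w")
    case True
    then have "k * (1 + norm a) \<le> k * (1 + 2 * norm w)" using k by (intro mult_left_mono) auto
    then show ?thesis using sep[OF a] k(3) norm_triangle_ineq3[of w a] by linarith
  next
    case False
    have "k * (1 + norm a) \<le> 1/4 * (1 + norm a)" using k by (intro mult_right_mono) auto
    also have "\<dots> \<le> norm a - norm w" using False w by (simp add: field_simps)
    also have "\<dots> \<le> norm (w - a)" by (metis norm_minus_commute norm_triangle_ineq2)
    finally show ?thesis .
  qed
  have pn: "(\<Prod>a\<in>#M. 1 + norm a) \<ge> 0" for M :: "complex multiset"
    by (induction M) auto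
  have prodge: "norm (\<Prod>a\<in>#M. w - a) \<ge> k ^ size M * (\<Prod>a\<in>#M. 1 + norm a)"
    if "\<And>a. a \<in># M \<Longrightarrow> a \<in># proots q" for M
    using that
  proof (induction M)
    case (add x M)
    have "k ^ size (add_mset x M) * (\<Prod>a\<in>#add_mset x M. 1 + norm a) = (k * (1 + norm x)) * (k ^ size M * (\<Prod>a\<in>#M. 1 + norm a))"
      by (simp add: mult_ac)
    also have "\<dots> \<le> norm (w - x) * norm (\<Prod>a\<in>#M. w - a)"
    proof (intro mult_mono)
      show "k ^ size M * (\<Prod>a\<in>#M. 1 + norm a) \<ge> 0"
        using k pn by (intro mult_nonneg_nonneg) auto
    qed (use add fac in auto)
    finally show ?case by (simp add: norm_mult)
  qed simp
  have "norm (coeff q j) = norm (coeff (smult (lead_coeff q) (\<Prod>a\<in>#proots q. [:-a, 1:])) j)"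
    by (simp only: complex_poly_decompose_multiset)
  also have "\<dots> \<le> norm (lead_coeff q) * (\<Prod>a\<in>#proots q. 1 + norm a)"
    by (simp add: norm_mult mult_left_mono norm_coeff_prod_linear_le)
  finally have 1: "1 \<le> norm (lead_coeff q) * (\<Prod>a\<in>#proots q. 1 + norm a)" using q by linarith
  have "k ^ d \<le> k ^ degree q" using deg k by (intro power_decreasing) auto
  also have "\<dots> = k ^ degree q * 1" by simp
  also have "\<dots> \<le> k ^ degree q * (norm (lead_coeff q) * (\<Prod>a\<in>#proots q. 1 + norm a))"
    using 1 k by (intro mult_left_mono) auto
  also have "\<dots> = norm (lead_coeff q) * (k ^ size (proots q) * (\<Prod>a\<in>#proots q. 1 + norm a))"
    by (simp add: size_proots_complex)
  also have "\<dots> \<le> norm (lead_coeff q) * norm (\<Prod>a\<in>#proots q. w - a)"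
    by (intro mult_left_mono prodge) auto
  also have "\<dots> = norm (poly (smult (lead_coeff q) (\<Prod>a\<in>#proots q. [:-a, 1:])) w)"
    by (simp add: poly_prod_mset norm_mult)
  also have "\<dots> = norm (poly q w)" by (simp only: complex_poly_decompose_multiset)
  finally show ?thesis .
qed

text \<open>\<open>F - w\<close> divides \<open>h(X, w) - h(X, F)\<close>, whose coefficients vanish
  strictly between \<open>d\<close> and \<open>N\<close>. With \<open>d + 1\<close> zeros in the
  disc all its coefficients up to \<open>d\<close> would be tiny, whereas \<open>big\<close> says
  that the one of \<open>X^i\<close>, a polynomial in \<open>w\<close>, is not.\<close>

lemma few_roots:
  fixes F :: "complex poly" and h :: "complex poly poly" and r :: real
  assumes F: "\<And>n. norm (coeff F n) \<le> 1" "degree F < p" "degree F > 0"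
    and h: "degrees_le h d" "\<And>i j. norm (coeff (coeff h j) i) \<le> 1"
    and vanish: "\<And>n. n < N \<Longrightarrow> coeff (poly h F) n = 0"
    and N: "d < N" and r: "0 \<le> r" "r \<le> 1" and i: "i \<le> d"
    and big: "2 ^ (d + 1) * (((real d + 1)\<^sup>2 * real p ^ d) * real (d * p) ^ (d + 1) * r ^ (N - 2 * (d + 1)))
              < norm (poly (map_poly (\<lambda>c. coeff c i) h) w)"
  shows "size (filter_mset (\<lambda>a. norm a < r) (proots (F - [:w:]))) \<le> d"
proof (rule ccontr)
  assume "\<not> ?thesis"
  then have size: "d + 1 \<le> size (filter_mset (\<lambda>a. norm a < r) (proots (F - [:w:])))" by simp
  obtain xs where xs: "mset xs = filter_mset (\<lambda>a. norm a < r) (proots (F - [:w:]))"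
    by (metis ex_mset)
  \<comment> \<open>Exactly \<open>d + 1\<close> of the zeros, with multiplicity, so that
    \<open>size A\<close> is the start of the gap.\<close>
  define A where "A = mset (take (d + 1) xs)"
  have "length xs \<ge> d + 1" using size unfolding xs[symmetric] by simp
  moreover have "mset xs = A + mset (drop (d + 1) xs)"
    unfolding A_def by (metis append_take_drop_id mset_append)
  ultimately have A: "A \<subseteq># filter_mset (\<lambda>a. norm a < r) (proots (F - [:w:]))" "size A = d + 1"
    unfolding xs[symmetric] by (simp_all add: A_def)
  define S where "S = poly h [:w:] - poly h F"
  have F0: "F - [:w:] \<noteq> 0" using F(3) by auto
  have "(\<Prod>a\<in>#A. [:-a, 1:]) dvd (\<Prod>a\<in>#proots (F - [:w:]). [:-a, 1:])"
    using A(1) by (intro prod_mset_subset_imp_dvd image_mset_subseteq_mono) (meson multiset_filter_subset subset_mset.order_trans)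
  also have "\<dots> dvd F - [:w:]"
    by (metis complex_poly_decompose_multiset dvd_smult dvd_refl)
  also have "F - [:w:] dvd S"
    unfolding S_def using diff_dvd_poly_diff[of F "[:w:]" h] by (metis dvd_minus_iff minus_diff_eq)
  finally obtain T where T: "S = (\<Prod>a\<in>#A. [:-a, 1:]) * T" by (auto elim: dvdE)
  have hd: "degree h \<le> d" "\<And>j. degree (coeff h j) \<le> d" using h(1) by (auto simp: degrees_le_def)
  have cw: "coeff (poly h [:w:]) n = poly (map_poly (\<lambda>c. coeff c n) h) w" for n
    by (induction h) (simp_all add: map_poly_pCons)
  have cw0: "coeff (poly h [:w:]) n = 0" if "n > d" for n
  proof -
    have "coeff (coeff h j) n = 0" for j using that hd(2)[of j] by (intro coeff_eq_0) auto
    then have "map_poly (\<lambda>c. coeff c n) h = 0" by (intro poly_eqI) (simp add: coeff_map_poly)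
    then show ?thesis by (simp add: cw)
  qed
  have Sbig: "norm (coeff S n) \<le> ((real d + 1)\<^sup>2 * real p ^ d) * r ^ (N - n)" if "n \<ge> d + 1" for n
  proof (cases "n < N")
    case True
    then show ?thesis using that r by (simp add: S_def cw0 vanish)
  next
    case False
    then show ?thesis using that norm_coeff_subst_le(1)[OF F(1,2) h, of n] by (simp add: S_def cw0)
  qed
  have degS: "degree S \<le> d * p"
  proof -
    have "degree (poly h [:w:]) \<le> d" using cw0 by (intro degree_le) auto
    also have "d \<le> d * p" using F(2) by (cases p) auto
    finally show ?thesis unfolding S_def using norm_coeff_subst_le(2)[OF F(1,2) h] by (intro degree_diff_le)
  qed
  have "norm (coeff S i) \<le> 2 ^ size A * (((real d + 1)\<^sup>2 * real p ^ d) * real (d * p) ^ size A * r ^ (N - 2 * size A))"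
    unfolding T
  proof (rule coeff_low_bound_of_roots)
    show "norm a \<le> r" if "a \<in># A" for a
      using mset_subset_eqD[OF A(1) that] by simp
  qed (use r degS[unfolded T] Sbig[unfolded T] A(2) i in auto)
  moreover have "coeff S i = poly (map_poly (\<lambda>c. coeff c i) h) w"
    using i N by (simp add: S_def vanish cw)
  ultimately show False using big A(2) by simp
qed

text \<open>Division by the largest modulus of a coefficient; \<open>(i, j)\<close> is a place where
  it is attained.\<close>

lemma normalize_bivariate:
  assumes "h \<noteq> 0" "degrees_le h d"
  obtains h' i j where "degrees_le h' d" "\<And>i j. norm (coeff (coeff h' j) i) \<le> 1"
    "norm (coeff (coeff h' j) i) = 1" "i \<le> d"
    "\<And>F n. coeff (poly h F) n = 0 \<Longrightarrow> coeff (poly h' F) n = 0"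
proof -
  define C where "C = (\<lambda>(i, j). norm (coeff (coeff h j) i)) ` ({..d} \<times> {..d})"
  have hd: "degree h \<le> d" "\<And>j. degree (coeff h j) \<le> d"
    using assms(2) by (auto simp: degrees_le_def)
  have finC: "finite C" "C \<noteq> {}" by (auto simp: C_def)
  have le: "norm (coeff (coeff h j) i) \<le> Max C" for i j
  proof (cases "i \<le> d \<and> j \<le> d")
    case True
    then show ?thesis using finC by (intro Max_ge) (auto simp: C_def)
  next
    case False
    then have "coeff (coeff h j) i = 0"
      using hd(1) hd(2)[of j] by (metis coeff_0 coeff_eq_0 linorder_not_le order_le_less_trans)
    moreover have "\<forall>x\<in>C. x \<ge> 0" by (auto simp: C_def)
    then have "Max C \<ge> 0" using Max_in[OF finC] by blast
    ultimately show ?thesis by simp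
  qed
  obtain i j where ij: "i \<le> d" "norm (coeff (coeff h j) i) = Max C"
  proof -
    have "Max C \<in> (\<lambda>(i, j). norm (coeff (coeff h j) i)) ` ({..d} \<times> {..d})"
      using Max_in[OF finC] by (simp only: C_def[symmetric])
    then show thesis using that by force
  qed
  have pos: "Max C > 0"
  proof (rule ccontr)
    assume "\<not> Max C > 0"
    then have "coeff (coeff h j) i = 0" for i j using le[of j i] by (metis norm_le_zero_iff not_less order_trans)
    then have "h = 0" by (intro poly_eqI) simp
    then show False using assms(1) by simp
  qed
  define h' where "h' = smult [:of_real (1 / Max C):] h"
  have c: "coeff (coeff h' j) i = coeff (coeff h j) i / of_real (Max C)" for i j
    by (simp add: h'_def)
  show thesis
  proof (rule that[of h' j i])
    show "degrees_le h' d" unfolding degrees_le_def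
    proof (intro conjI allI)
      show "degree h' \<le> d" using hd(1) pos unfolding h'_def by (intro degree_smult_le[THEN order_trans])
      show "degree (coeff h' j) \<le> d" for j
        using hd(2)[of j] by (intro degree_le) (auto simp: c coeff_eq_0)
    qed
    show "norm (coeff (coeff h' j) i) \<le> 1" for i j
      using le pos by (simp add: c norm_divide)
    show "norm (coeff (coeff h' j) i) = 1" using ij pos by (simp add: c norm_divide)
    show "coeff (poly h' F) n = 0" if "coeff (poly h F) n = 0" for F n
      using that by (simp add: h'_def)
  qed (rule ij)
qed

section \<open>Dyadic sums of logarithms\<close>

text \<open>A term vanishes unless \<open>R j < x\<close>; otherwise \<open>ln t <= t - 1\<close>
  bounds it by \<open>2^j x\<close>. The powers of 2 up to \<open>x\<close> add up to at most
  \<open>2x\<close>.\<close>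

lemma dyadic_log_sum_le:
  fixes x :: real and R :: "nat \<Rightarrow> real"
  assumes R: "\<And>j. 2 ^ j \<le> R j" and x: "x \<ge> 0"
  shows "(\<Sum>j<J. 4 ^ j * (ln (max x (R j)) - ln (R j))) \<le> 2 * x\<^sup>2"
proof -
  have Rpos: "R j > 0" for j using R[of j] by (meson less_le_trans zero_less_numeral zero_less_power)
  have tm: "4 ^ j * (ln (max x (R j)) - ln (R j)) \<le> x * (if 2 ^ j \<le> x then 2 ^ j else 0)" for j
  proof (cases "x \<le> R j")
    case True
    then show ?thesis using x by (simp add: max_absorb2)
  next
    case False
    then have xR: "x > R j" "x \<ge> 2 ^ j" using R[of j] by auto
    have "ln x - ln (R j) = ln (x / R j)" using xR Rpos[of j] by (simp add: ln_div)
    also have "\<dots> \<le> x / R j - 1" using xR Rpos[of j] by (intro ln_le_minus_one) auto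
    also have "\<dots> \<le> x / 2 ^ j" 
      using frac_le[of x x "2 ^ j" "R j"] R[of j] x by simp
    finally have "4 ^ j * (ln (max x (R j)) - ln (R j)) \<le> 4 ^ j * (x / 2 ^ j)"
      using xR by (intro mult_left_mono) auto
    also have "4 ^ j * (x / 2 ^ j) = x * 2 ^ j"
    proof -
      have "(4::real) ^ j = 2 ^ j * 2 ^ j" by (simp flip: power_mult_distrib)
      then show ?thesis by simp
    qed
    finally show ?thesis using xR(2) by (simp only: if_True)
  qed
  \<comment> \<open>The second conjunct serves the induction: if \<open>2^J <= x\<close>, adding
    \<open>2^J\<close> to a sum of at most \<open>2^J\<close> stays within
    \<open>2x\<close>.\<close>
  have "(\<Sum>j<J. if 2 ^ j \<le> x then 2 ^ j else 0) \<le> 2 * x \<and> (\<Sum>j<J. if 2 ^ j \<le> x then 2 ^ j else 0) \<le> (2::real) ^ J"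
    using x by (induction J) auto
  then have "x * (\<Sum>j<J. if 2 ^ j \<le> x then 2 ^ j else 0) \<le> x * (2 * x)"
    using x by (intro mult_left_mono) auto
  moreover have "(\<Sum>j<J. 4 ^ j * (ln (max x (R j)) - ln (R j))) \<le> x * (\<Sum>j<J. if 2 ^ j \<le> x then 2 ^ j else 0)"
    unfolding sum_distrib_left by (intro sum_mono tm)
  ultimately show ?thesis by (simp add: power2_eq_square)
qed

text \<open>For \<open>4 <= x < 2^(J+2)\<close> the single term with
  \<open>2^(j+2) <= x < 2^(j+3)\<close> suffices: its logarithm is at least
  \<open>ln 2 >= 1/2\<close>, and \<open>x^2 < 64 * 4^j\<close>. Outside this range the left side is
  at most 0, thanks to the 16 for small \<open>x\<close> and to the fourth power for large
  \<open>x\<close>.\<close>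

lemma dyadic_log_sum_ge:
  fixes x :: real and R :: "nat \<Rightarrow> real"
  assumes R: "\<And>j. 2 ^ j \<le> R j" "\<And>j. R j \<le> 2 ^ Suc j" and x: "x \<ge> 0"
  shows "(x\<^sup>2 - 16 - x ^ 4 / 4 ^ (J + 2)) / 128 \<le> (\<Sum>j<J. 4 ^ j * (ln (max x (R j)) - ln (R j)))"
proof -
  have Rpos: "R j > 0" for j using R(1)[of j] by (meson less_le_trans zero_less_numeral zero_less_power)
  have nonneg: "4 ^ j * (ln (max x (R j)) - ln (R j)) \<ge> 0" for j
    using Rpos[of j] by (intro mult_nonneg_nonneg) auto
  have ln2: "ln 2 \<ge> (1/2::real)"
    using ln_le_minus_one[of "1/2"] by (simp add: ln_div)
  have main: "x\<^sup>2 / 128 \<le> (\<Sum>j<J. 4 ^ j * (ln (max x (R j)) - ln (R j)))" if "4 \<le> x" "x < 2 ^ (J + 2)" for J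
    using that(2)
  proof (induction J)
    case 0
    then show ?case using that(1) by simp
  next
    case (Suc J)
    show ?case
    proof (cases "x < 2 ^ (J + 2)")
      case True
      then show ?thesis using Suc.IH nonneg[of J] by simp
    next
      case False
      have "R J * 2 \<le> x" using R(2)[of J] False by simp
      then have "ln (R J * 2) \<le> ln (max x (R J))" using Rpos[of J] by (subst ln_le_cancel_iff) auto
      then have "ln (max x (R J)) - ln (R J) \<ge> 1/2" using Rpos[of J] ln2 by (simp add: ln_mult)
      then have "4 ^ J * (1/2) \<le> 4 ^ J * (ln (max x (R J)) - ln (R J))" by (intro mult_left_mono) auto
      moreover have "x\<^sup>2 \<le> (2 ^ (J + 3))\<^sup>2" using Suc.prems x by (intro power_mono) (auto simp: numeral_3_eq_3)
      moreover have "((2::real) ^ (J + 3))\<^sup>2 = 64 * 4 ^ J"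
        by (simp add: power_add power2_eq_square flip: power_mult_distrib)
      ultimately have "x\<^sup>2 / 128 \<le> 4 ^ J * (ln (max x (R J)) - ln (R J))" by linarith
      moreover have "0 \<le> (\<Sum>j<J. 4 ^ j * (ln (max x (R j)) - ln (R j)))" by (intro sum_nonneg nonneg)
      ultimately show ?thesis unfolding sum.lessThan_Suc by linarith
    qed
  qed
  have sum0: "0 \<le> (\<Sum>j<J. 4 ^ j * (ln (max x (R j)) - ln (R j)))" by (intro sum_nonneg nonneg)
  consider "x < 4" | "4 \<le> x" "x < 2 ^ (J + 2)" | "x \<ge> 2 ^ (J + 2)" by linarith
  then show ?thesis
  proof cases
    case 1
    then have "x\<^sup>2 \<le> 16" using x power_mono[of x 4 2] by simp
    moreover have "x ^ 4 / 4 ^ (J + 2) \<ge> 0" using x by simp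
    ultimately have "x\<^sup>2 - 16 - x ^ 4 / 4 ^ (J + 2) \<le> 0" by linarith
    then show ?thesis using sum0 by (simp add: order_trans[of _ 0])
  next
    case 2
    have "x ^ 4 / 4 ^ (J + 2) \<ge> 0" using x by simp
    then have "x\<^sup>2 - 16 - x ^ 4 / 4 ^ (J + 2) \<le> x\<^sup>2" by linarith
    then have "(x\<^sup>2 - 16 - x ^ 4 / 4 ^ (J + 2)) / 128 \<le> x\<^sup>2 / 128"
      by (rule divide_right_mono) simp
    then show ?thesis using main[OF 2] by (rule order_trans)
  next
    case 3
    have "x\<^sup>2 * 4 ^ (J + 2) \<le> x\<^sup>2 * x\<^sup>2"
    proof (intro mult_left_mono)
      have "(2 ^ (J + 2))\<^sup>2 \<le> x\<^sup>2" using 3 by (intro power_mono) auto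
      moreover have "((2::real) ^ (J + 2))\<^sup>2 = 4 ^ (J + 2)"
        by (simp add: power2_eq_square flip: power_mult_distrib)
      ultimately show "4 ^ (J + 2) \<le> x\<^sup>2" by simp
    qed simp
    then have "x\<^sup>2 \<le> x ^ 4 / 4 ^ (J + 2)" by (simp add: pos_le_divide_eq flip: power_add)
    then show ?thesis using sum0 by (simp add: order_trans[of _ 0])
  qed
qed

text \<open>Of the \<open>d + 1\<close> points \<open>pt t\<close>, spaced by
  \<open>4 \<delta>\<close>, the at most \<open>d\<close> elements of \<open>B\<close> can spoil
  only \<open>d\<close>. Moving a good one by less than \<open>\<delta>\<close> avoids the finite
  set \<open>X\<close> as well.\<close>

lemma exists_separated_point:
  fixes c :: real
  assumes B: "finite B" "card B \<le> d" and X: "finite X"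
  obtains R where "c \<le> R" "R \<le> c + 1" "R \<notin> X" "\<And>b. b \<in> B \<Longrightarrow> \<bar>R - b\<bar> \<ge> 1 / (4 * (real d + 1))"
proof -
  define \<delta> where "\<delta> = 1 / (4 * (real d + 1))"
  have \<delta>: "\<delta> > 0" "4 * (real d + 1) * \<delta> = 1" by (simp_all add: \<delta>_def)
  define pt where "pt = (\<lambda>t::nat. c + (4 * real t + 2) * \<delta>)"
  have "\<exists>t\<in>{..d}. \<forall>b\<in>B. \<bar>pt t - b\<bar> \<ge> 2 * \<delta>"
  proof (rule ccontr)
    assume "\<not> ?thesis"
    then have "\<forall>t\<in>{..d}. \<exists>b. b \<in> B \<and> \<bar>pt t - b\<bar> < 2 * \<delta>" by (metis not_le)
    then obtain f where f: "\<And>t. t \<in> {..d} \<Longrightarrow> f t \<in> B \<and> \<bar>pt t - f t\<bar> < 2 * \<delta>" by metis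
    have "inj_on f {..d}"
    proof (rule inj_onI)
      fix t u assume tu: "t \<in> {..d}" "u \<in> {..d}" "f t = f u"
      have "\<bar>pt t - pt u\<bar> < 4 * \<delta>" using f[OF tu(1)] f[OF tu(2)] tu(3) by (auto simp: abs_if split: if_splits)
      moreover have "pt t - pt u = 4 * \<delta> * (real t - real u)" by (simp add: pt_def algebra_simps)
      ultimately have "4 * \<delta> * \<bar>real t - real u\<bar> < 4 * \<delta> * 1" using \<delta> by (simp add: abs_mult)
      then have "\<bar>real t - real u\<bar> < 1" using \<delta> by (subst (asm) mult_less_cancel_left_pos) auto
      then show "t = u" by linarith
    qed
    then have "card {..d} \<le> card B" using f B(1) by (intro card_inj_on_le[of f]) auto
    then show False using B(2) by simp
  qed
  then obtain t where t: "t \<le> d" "\<And>b. b \<in> B \<Longrightarrow> \<bar>pt t - b\<bar> \<ge> 2 * \<delta>" by auto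
  have "infinite {pt t - \<delta><..<pt t + \<delta>}" using \<delta> by simp
  then obtain R where R: "R \<in> {pt t - \<delta><..<pt t + \<delta>}" "R \<notin> X" using X by (meson finite_subset subsetI)
  show thesis
  proof (rule that[of R])
    have "\<delta> * real t \<ge> 0" "\<delta> * real t \<le> \<delta> * real d" using \<delta> t(1) by (auto intro: mult_left_mono)
    moreover have "pt t = c + 4 * (\<delta> * real t) + 2 * \<delta>" by (simp add: pt_def algebra_simps)
    moreover have "4 * (\<delta> * real d) + 4 * \<delta> = 1" using \<delta>(2) by (simp add: algebra_simps)
    moreover have "pt t - \<delta> < R" "R < pt t + \<delta>" using R(1) by auto
    ultimately show "c \<le> R" "R \<le> c + 1" using \<delta>(1) by linarith+
    show "\<bar>R - b\<bar> \<ge> 1 / (4 * (real d + 1))" if "b \<in> B" for b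
      using t(2)[OF that] R(1) unfolding \<delta>_def[symmetric] by (auto simp: abs_if split: if_splits)
  qed (rule R(2))
qed

section \<open>Algebraic approximations of Fekete polynomials\<close>

lemma norm_coeff_fekete_cpoly:
  assumes "prime p" "2 < p"
  shows "norm (coeff (fekete_cpoly p) n) = (if 0 < n \<and> n < p then 1 else 0)"
proof (cases "0 < n \<and> n < p")
  case True
  then have "coprime (int n) (int p)"
    using coprime_prime_iff[OF assms, of "int n"] by (auto dest: dvd_imp_le)
  then have "Legendre (int n) (int p) \<noteq> 0"
    using Legendre_square_eq_1[OF assms, of "int n"] by auto
  then have "Legendre (int n) (int p) = 1 \<or> Legendre (int n) (int p) = -1"
    using Legendre_values[of "int n" "int p"] by auto
  then show ?thesis using True by (auto simp: coeff_fekete_cpoly)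
next
  case False
  then show ?thesis by (auto simp: coeff_fekete_cpoly Legendre_def)
qed

lemma degree_fekete_cpoly_eq:
  assumes "prime p" "2 < p"
  shows "degree (fekete_cpoly p) = p - 1"
proof (rule antisym)
  show "degree (fekete_cpoly p) \<le> p - 1" using degree_fekete_cpoly[of p] assms by linarith
  have "norm (coeff (fekete_cpoly p) (p - 1)) = 1"
    using assms by (simp add: norm_coeff_fekete_cpoly)
  then show "p - 1 \<le> degree (fekete_cpoly p)" by (intro le_degree) auto
qed

lemma sum_norm_square_fekete:
  fixes r :: real
  assumes "prime p" "2 < p" "p \<le> K"
  shows "(\<Sum>z\<in>unity_roots K. (norm (poly (fekete_cpoly p) (r * z)))\<^sup>2) = real K * (\<Sum>n\<in>{1..<p}. r ^ (2 * n))"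
proof -
  have "(\<Sum>z\<in>unity_roots K. (norm (poly (fekete_cpoly p) (r * z)))\<^sup>2)
     = real K * (\<Sum>n\<le>p - 1. (if 0 < n \<and> n < p then 1 else 0) * r ^ (2 * n))"
  proof (subst sum_norm_square_unity_roots)
    show "degree (fekete_cpoly p) < K" using degree_fekete_cpoly_eq[OF assms(1,2)] assms by simp
    have sq: "(norm (coeff (fekete_cpoly p) n))\<^sup>2 = (if 0 < n \<and> n < p then 1 else 0)" for n
      unfolding norm_coeff_fekete_cpoly[OF assms(1,2)] by simp
    show "real K * (\<Sum>n\<le>degree (fekete_cpoly p). (norm (coeff (fekete_cpoly p) n))\<^sup>2 * r ^ (2 * n))
      = real K * (\<Sum>n\<le>p - 1. (if 0 < n \<and> n < p then 1 else 0) * r ^ (2 * n))"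
      unfolding sq degree_fekete_cpoly_eq[OF assms(1,2)] ..
  qed
  also have "(\<Sum>n\<le>p - 1. (if 0 < n \<and> n < p then 1 else 0) * r ^ (2 * n)) = (\<Sum>n\<in>{1..<p}. r ^ (2 * n))"
    by (rule sum.mono_neutral_cong_right) auto
  finally show ?thesis .
qed

text \<open>\<open>F(0) = 0\<close> and \<open>K\<close> exceeds the degree of \<open>F^4\<close>,
  so the mean of \<open>F^4\<close> is 0. The strip of half-width \<open>2 sqrt p\<close> then
  yields the constant \<open>8 * 4p\<close>.\<close>

lemma sum_norm_power4_fekete:
  fixes r :: real
  assumes p: "prime p" "2 < p" and K: "4 * p \<le> K" and r: "0 \<le> r" "r < 1" "r ^ p / (1 - r) \<le> 1/2"
  shows "(\<Sum>z\<in>unity_roots K. norm (poly (fekete_cpoly p) (r * z)) ^ 4)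
    \<le> 32 * p * (\<Sum>z\<in>unity_roots K. (norm (poly (fekete_cpoly p) (r * z)))\<^sup>2)"
proof -
  have "K > 0" using K p by simp
  have nz: "norm (of_real r * z) = r" if "z \<in> unity_roots K" for z :: complex
    using norm_unity_root[OF \<open>K > 0\<close> that] r by (simp add: norm_mult)
  have "degree (fekete_cpoly p ^ 4) \<le> (p - 1) * 4"
    using degree_power_le[of "fekete_cpoly p" 4] p by (simp add: degree_fekete_cpoly_eq)
  then have "degree (fekete_cpoly p ^ 4) < K" using K p by linarith
  from sum_poly_unity_roots[OF this, of r]
  have s: "(\<Sum>z\<in>unity_roots K. poly (fekete_cpoly p) (r * z) ^ 4) = 0"
    by (simp add: coeff_0_power coeff_fekete_cpoly Legendre_def)
  have "(\<forall>z\<in>unity_roots K. \<bar>Re (poly (fekete_cpoly p) (r * z))\<bar> \<le> 2 * sqrt p) \<or>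
        (\<forall>z\<in>unity_roots K. \<bar>Im (poly (fekete_cpoly p) (r * z))\<bar> \<le> 2 * sqrt p)"
  proof (cases "Legendre (-1) p = 1")
    case True
    have "\<bar>Re (poly (fekete_cpoly p) (of_real r * z))\<bar> \<le> 2 * sqrt p" if "z \<in> unity_roots K" for z
      using fekete_strip[OF p, of "of_real r * z"] r(2,3) unfolding nz[OF that] if_P[OF True] by blast
    then show ?thesis by blast
  next
    case False
    have "\<bar>Im (poly (fekete_cpoly p) (of_real r * z))\<bar> \<le> 2 * sqrt p" if "z \<in> unity_roots K" for z
      using fekete_strip[OF p, of "of_real r * z"] r(2,3) unfolding nz[OF that] if_not_P[OF False] by blast
    then show ?thesis by blast
  qed
  from sum_norm_power4_le[OF s this] show ?thesis by (simp add: power_mult_distrib)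
qed

text \<open>Compares the circles of radius \<open>1 - s\<close> and about \<open>1 - 4000 s\<close>.
  The second moment \<open>E\<close> drops from at least \<open>1 / (3s)\<close> to at most
  \<open>1 / (4000 s)\<close>, while few zeros allow the logarithmic means to grow too little for
  that. \<open>B\<close> collects moduli near which nothing is known about the zeros of
  \<open>F - w\<close>.\<close>

lemma fekete_few_roots_contradiction:
  fixes p d :: nat and s :: real and B :: "real set"
  assumes p: "prime p" "2 < p" and s: "0 < s" "s \<le> 1/10000" "real p * real d * s\<^sup>2 \<le> 1/10^9"
    and dec: "(1 - s) ^ p \<le> s / 2" and B: "finite B" "card B \<le> d"
    and roots: "\<And>w. 1 \<le> norm w \<Longrightarrow> norm w \<le> 16 * p \<Longrightarrow>
       (\<And>b. b \<in> B \<Longrightarrow> \<bar>norm w - b\<bar> \<ge> 1 / (4 * (real d + 1))) \<Longrightarrow>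
       size (filter_mset (\<lambda>a. norm a < 1 - s) (proots (fekete_cpoly p - [:w:]))) \<le> d"
  shows False
proof -
  define F where "F = fekete_cpoly p"
  define r1 where "r1 = 1 - s"
  define E where "E = (\<lambda>r::real. \<Sum>n\<in>{1..<p}. r ^ (2 * n))"
  \<comment> \<open>This size makes the sampling error \<open>degree F * ln 2 / K1\<close> at most
    \<open>e = 1 / (32 p)\<close>. As \<open>4 ^ J < 16 p\<close>, it costs with the error
    \<open>e\<close> itself at most 1 in total.\<close>
  define K1 where "K1 = 32 * p\<^sup>2"
  have p3: "real p \<ge> 3" using p by simp
  have K1: "K1 > 0" "4 * p \<le> K1" "p \<le> K1" using p by (auto simp: K1_def power2_eq_square)
  have r1: "0 < r1" "r1 < 1" using s by (auto simp: r1_def)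
  have degF: "degree F = p - 1" using degree_fekete_cpoly_eq[OF p] by (simp add: F_def)

  \<comment> \<open>The dyadic radii run up to about \<open>sqrt p\<close>:
    \<open>4^(J+2) >= 64 p\<close> is twice the constant \<open>32 p\<close> of the fourth moment
    bound, so large values of \<open>F\<close> cost only half of the second moment.\<close>
  obtain J where J: "4 * p \<le> 4 ^ J" "4 ^ J < 16 * p"
  proof -
    define J where "J = (LEAST J. 4 * p \<le> 4 ^ J)"
    have "4 * p \<le> 4 ^ (4 * p)" by (rule less_imp_le[OF power_gt_expt]) simp
    then have 1: "4 * p \<le> 4 ^ J" unfolding J_def by (rule LeastI)
    then have "J \<noteq> 0" using p by (cases J) auto
    then obtain J' where J': "J = Suc J'" by (cases J) auto
    then have "\<not> 4 * p \<le> 4 ^ J'" using not_less_Least[of J' "\<lambda>J. 4 * p \<le> 4 ^ J"] by (simp add: J_def)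
    then have "4 ^ J < 16 * p" by (simp add: J')
    with 1 show thesis by (rule that)
  qed
  have Jr: "4 * real p \<le> 4 ^ J" "4 ^ J < 16 * real p"
  proof -
    have "real (4 * p) \<le> real (4 ^ J)" "real (4 ^ J) < real (16 * p)"
      using J by (simp_all only: of_nat_le_iff of_nat_less_iff)
    then show "4 * real p \<le> 4 ^ J" "4 ^ J < 16 * real p" by simp_all
  qed

  define X where "X = (\<lambda>z. norm (poly F (of_real r1 * z))) ` unity_roots K1"
  have "finite X" using K1 by (simp add: X_def finite_roots_unity)
  have "\<exists>R. 2 ^ j \<le> R \<and> R \<le> 2 ^ j + 1 \<and> R \<notin> X \<and> (\<forall>b\<in>B. \<bar>R - b\<bar> \<ge> 1 / (4 * (real d + 1)))" for j :: nat
    using exists_separated_point[OF B \<open>finite X\<close>, of "2 ^ j"] by metis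
  then obtain R where R: "\<And>j. 2 ^ j \<le> R j" "\<And>j. R j \<le> 2 ^ j + 1" "\<And>j. R j \<notin> X"
     "\<And>j b. b \<in> B \<Longrightarrow> \<bar>R j - b\<bar> \<ge> 1 / (4 * (real d + 1))"
    by metis
  have R1: "R j \<ge> 1" for j using R(1)[of j] by (meson one_le_numeral one_le_power order_trans)
  have R2: "R j \<le> 2 ^ Suc j" for j
  proof -
    have "(1::real) \<le> 2 ^ j" by simp
    then show ?thesis using R(2)[of j] unfolding power_Suc by linarith
  qed
  have R16: "R j \<le> 16 * p" if "j < J" for j
  proof -
    have "R j \<le> 2 ^ J" using R2[of j] power_increasing[of "Suc j" J "2::real"] that by simp
    also have "\<dots> \<le> 4 ^ J" by (intro power_mono) auto
    finally show ?thesis using Jr by linarith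
  qed

  define e where "e = 1 / (32 * real p)"
  have epos: "e > 0" using p by (simp add: e_def)
  \<comment> \<open>The inner radius can be prescribed only up to an interval. The bound 4000 makes
    \<open>2 * E r0\<close> small against \<open>E r1 / 256\<close>; the bound 5000 keeps
    \<open>r0\<close> above \<open>1/2\<close>.\<close>
  obtain r0 K0 where r0: "1 - 5000 * s < r0" "r0 < 1 - 4000 * s" and K0: "K0 > p" and
    inc: "\<And>x. x \<in> R ` {..<J} \<Longrightarrow>
      (\<Sum>z\<in>unity_roots K1. ln (max (norm (poly F (of_real r1 * z))) x)) / K1
      \<le> (\<Sum>z\<in>unity_roots K0. ln (max (norm (poly F (of_real r0 * z))) x)) / K0
        + d * ln (r1 / r0) + degree F * ln 2 / K1 + e"
  proof (rule log_max_mean_increment[where F = F and ?K1.0 = K1 and ra = "1 - 5000 * s" and rb = "1 - 4000 * s"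
        and ?r1.0 = r1 and Rs = "R ` {..<J}" and d = d and e = e and Kmin = p])
    show "degree F > 0" using p degF by simp
    show "0 < 1 - 5000 * s" "1 - 5000 * s < 1 - 4000 * s" "1 - 4000 * s \<le> r1" using s by (auto simp: r1_def)
    show "finite (R ` {..<J})" by simp
    show "x > 0" if "x \<in> R ` {..<J}" for x using R1 that by (auto intro: less_le_trans[OF zero_less_one])
    show "norm (poly F (of_real r1 * z)) \<noteq> x" if x: "x \<in> R ` {..<J}" and z: "z \<in> unity_roots K1" for x z
    proof
      assume "norm (poly F (of_real r1 * z)) = x"
      then have "x \<in> X" using z unfolding X_def by blast
      then show False using x R(3) by blast
    qed
    show "size (filter_mset (\<lambda>a. norm a < r1) (proots (F - [:w:]))) \<le> d" if w: "norm w \<in> R ` {..<J}" for w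
    proof -
      obtain j where "j < J" "norm w = R j" using w by auto
      then show ?thesis unfolding F_def r1_def using R1 R16 R(4) by (intro roots) auto
    qed
  qed (use K1 epos in blast)+
  have K0pos: "K0 > 0" using K0 by simp
  have r0': "1/2 < r0" "r0 < 1" using r0 s by auto

  \<comment> \<open>The weights \<open>4^j\<close> turn logarithms into squares: \<open>G x\<close>
    is comparable to \<open>x^2\<close> for \<open>x\<close> between about 4 and
    \<open>2^J\<close>.\<close>
  define G where "G = (\<lambda>x. \<Sum>j<J. 4 ^ j * (ln (max x (R j)) - ln (R j)))"
  have meanG: "(\<Sum>z\<in>unity_roots K. G (f z)) / K = (\<Sum>j<J. 4 ^ j * ((\<Sum>z\<in>unity_roots K. ln (max (f z) (R j))) / K - ln (R j)))"
    if "K > 0" for K :: nat and f :: "complex \<Rightarrow> real"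
  proof -
    have "(\<Sum>z\<in>unity_roots K. G (f z)) = (\<Sum>j<J. \<Sum>z\<in>unity_roots K. 4 ^ j * (ln (max (f z) (R j)) - ln (R j)))"
      unfolding G_def by (rule sum.swap)
    also have "\<dots> = (\<Sum>j<J. 4 ^ j * ((\<Sum>z\<in>unity_roots K. ln (max (f z) (R j))) - K * ln (R j)))"
      using that by (simp add: sum_subtractf card_roots_unity_eq flip: sum_distrib_left)
    finally have "(\<Sum>z\<in>unity_roots K. G (f z)) / K
      = (\<Sum>j<J. 4 ^ j * ((\<Sum>z\<in>unity_roots K. ln (max (f z) (R j))) - K * ln (R j)) / K)"
      by (simp only: sum_divide_distrib)
    moreover have "a * (S - K * l) / K = a * (S / K - l)" for a S l :: real
      using that by (simp add: field_simps)
    ultimately show ?thesis by simp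
  qed
  define err where "err = d * ln (r1 / r0) + degree F * ln 2 / K1 + e"
  have main: "(\<Sum>z\<in>unity_roots K1. G (norm (poly F (of_real r1 * z)))) / K1
     \<le> (\<Sum>z\<in>unity_roots K0. G (norm (poly F (of_real r0 * z)))) / K0 + 4 ^ J * err"
  proof -
    have r10: "ln (r1 / r0) \<ge> 0" using r0 r0' s by (intro ln_ge_zero) (auto simp: r1_def field_simps)
    then have err0: "err \<ge> 0" using epos by (auto simp: err_def intro!: add_nonneg_nonneg)
    have "3 * (\<Sum>j<J. 4 ^ j) = (4::real) ^ J - 1" by (induction J) auto
    moreover have "(\<Sum>j<J. 4 ^ j) \<ge> (0::real)" by (intro sum_nonneg) auto
    ultimately have "(\<Sum>j<J. 4 ^ j) \<le> (4::real) ^ J" by linarith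
    then have "(\<Sum>j<J. 4 ^ j) * err \<le> 4 ^ J * err" using err0 by (rule mult_right_mono)
    then have "(\<Sum>j<J. 4 ^ j * err) \<le> 4 ^ J * err" by (simp only: sum_distrib_right)
    moreover have "4 ^ j * ((\<Sum>z\<in>unity_roots K1. ln (max (norm (poly F (of_real r1 * z))) (R j))) / K1 - ln (R j))
       \<le> 4 ^ j * ((\<Sum>z\<in>unity_roots K0. ln (max (norm (poly F (of_real r0 * z))) (R j))) / K0 - ln (R j)) + 4 ^ j * err"
      if "j < J" for j
      unfolding distrib_left[symmetric] using inc[of "R j"] that by (intro mult_left_mono) (auto simp: err_def)
    then have "(\<Sum>j<J. 4 ^ j * ((\<Sum>z\<in>unity_roots K1. ln (max (norm (poly F (of_real r1 * z))) (R j))) / K1 - ln (R j)))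
       \<le> (\<Sum>j<J. 4 ^ j * ((\<Sum>z\<in>unity_roots K0. ln (max (norm (poly F (of_real r0 * z))) (R j))) / K0 - ln (R j)) + 4 ^ j * err)"
      by (intro sum_mono) auto
    ultimately show ?thesis unfolding meanG[OF K1(1)] meanG[OF K0pos] sum.distrib by linarith
  qed

  have upper: "(\<Sum>z\<in>unity_roots K0. G (norm (poly F (of_real r0 * z)))) / K0 \<le> 2 * E r0"
  proof -
    have "(\<Sum>z\<in>unity_roots K0. G (norm (poly F (of_real r0 * z)))) \<le> (\<Sum>z\<in>unity_roots K0. 2 * (norm (poly F (of_real r0 * z)))\<^sup>2)"
      unfolding G_def by (intro sum_mono dyadic_log_sum_le R(1)) auto
    also have "\<dots> = K0 * (2 * E r0)"
      using sum_norm_square_fekete[OF p, of K0 r0] K0 by (simp add: F_def E_def flip: sum_distrib_left)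
    finally show ?thesis using K0pos by (simp add: field_simps)
  qed
  have lower: "(E r1 / 2 - 16) / 128 \<le> (\<Sum>z\<in>unity_roots K1. G (norm (poly F (of_real r1 * z)))) / K1"
  proof -
    let ?f = "\<lambda>z. norm (poly F (of_real r1 * z))"
    have S2: "(\<Sum>z\<in>unity_roots K1. (?f z)\<^sup>2) = K1 * E r1"
      using sum_norm_square_fekete[OF p K1(3), of r1] by (simp add: F_def E_def)
    have "r1 ^ p / (1 - r1) \<le> 1/2" using dec s by (simp add: r1_def field_simps)
    then have S4: "(\<Sum>z\<in>unity_roots K1. ?f z ^ 4) \<le> 32 * p * (K1 * E r1)"
      using sum_norm_power4_fekete[OF p K1(2), of r1] r1 S2 by (simp add: F_def)
    have E0: "E r1 \<ge> 0" using r1 by (auto simp: E_def intro!: sum_nonneg)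
    have "(\<Sum>z\<in>unity_roots K1. ?f z ^ 4) / 4 ^ (J + 2) \<le> 32 * p * (K1 * E r1) / (64 * p)"
      using S4 Jr(1) p E0 by (intro frac_le) (auto simp: sum_nonneg)
    also have "\<dots> = K1 * E r1 / 2" using p by simp
    finally have S4': "(\<Sum>z\<in>unity_roots K1. ?f z ^ 4) / 4 ^ (J + 2) \<le> K1 * E r1 / 2" .
    have "(K1 * E r1 - 16 * K1 - K1 * E r1 / 2) / 128 \<le> (K1 * E r1 - 16 * K1 - (\<Sum>z\<in>unity_roots K1. ?f z ^ 4) / 4 ^ (J + 2)) / 128"
      using S4' by (intro divide_right_mono) linarith+
    also have "\<dots> = (\<Sum>z\<in>unity_roots K1. ((?f z)\<^sup>2 - 16 - ?f z ^ 4 / 4 ^ (J + 2)) / 128)"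
      by (simp only: sum_divide_distrib[symmetric] sum_subtractf sum_constant card_roots_unity_eq[OF K1(1)] S2
          of_nat_mult of_nat_numeral mult.commute[of _ 16])
    also have "\<dots> \<le> (\<Sum>z\<in>unity_roots K1. G (?f z))"
      unfolding G_def by (intro sum_mono dyadic_log_sum_ge R(1) R2) auto
    finally show ?thesis using K1(1) by (simp add: field_simps)
  qed

  have err_le: "4 ^ J * err \<le> 160000 * (real p * real d * s) + 1"
  proof -
    have "ln (r1 / r0) \<le> r1 / r0 - 1" using r1 r0' by (intro ln_le_minus_one) auto
    also have "\<dots> = (r1 - r0) / r0" using r0' by (simp add: field_simps)
    also have "\<dots> \<le> (5000 * s) / (1/2)" using r0 r0' s by (intro frac_le) (auto simp: r1_def)
    finally have "d * ln (r1 / r0) \<le> d * (10000 * s)" by (intro mult_left_mono) auto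
    moreover have "degree F * ln 2 / K1 \<le> p * 1 / (32 * (real p)\<^sup>2)"
      unfolding K1_def of_nat_mult of_nat_power using degF p ln_2_less_1 by (intro frac_le mult_mono) auto
    moreover have "p * 1 / (32 * (real p)\<^sup>2) = e" using p by (simp add: e_def power2_eq_square)
    ultimately have "err \<le> d * (10000 * s) + 2 * e" by (simp add: err_def)
    then have "4 ^ J * err \<le> 4 ^ J * (d * (10000 * s) + 2 * e)" by (intro mult_left_mono) auto
    also have "\<dots> \<le> (16 * real p) * (d * (10000 * s) + 2 * e)"
      using Jr s epos by (intro mult_right_mono) auto
    also have "\<dots> = 160000 * (real p * real d * s) + 1" using p by (simp add: e_def field_simps)
    finally show ?thesis .
  qed

  have Egeo: "E r * (1 - r\<^sup>2) = r\<^sup>2 - r ^ (2 * p)" for r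
  proof -
    have "(\<Sum>n\<in>{1..<q}. Q ^ n) * (1 - Q) = Q - Q ^ q" if "q \<ge> 1" for q and Q :: real
      using that
    proof (induction q rule: dec_induct)
      case (step n)
      have "(\<Sum>n\<in>{1..<Suc n}. Q ^ n) * (1 - Q) = (\<Sum>n\<in>{1..<n}. Q ^ n) * (1 - Q) + Q ^ n * (1 - Q)"
        using step(1) by (simp only: sum.atLeastLessThan_Suc distrib_right)
      also have "\<dots> = Q - Q ^ Suc n" unfolding step.IH by (simp add: algebra_simps)
      finally show ?case .
    qed simp
    from this[of p "r\<^sup>2"] p show ?thesis by (simp add: E_def power_mult)
  qed
  have E0: "E r0 \<le> 1 / (4000 * s)"
  proof -
    have "4000 * s \<le> 1 - r0" using r0 by simp
    also have "\<dots> \<le> 1 - r0\<^sup>2" using r0' by (simp add: power2_eq_square mult_le_cancel_right1)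
    finally have le: "4000 * s \<le> 1 - r0\<^sup>2" .
    have "E r0 = (r0\<^sup>2 - r0 ^ (2 * p)) / (1 - r0\<^sup>2)" using Egeo[of r0] le s(1) by (simp add: eq_divide_eq)
    also have "\<dots> \<le> 1 / (4000 * s)"
    proof (intro frac_le)
      have "r0\<^sup>2 \<le> 1" "r0 ^ (2 * p) \<ge> 0" using r0' by (auto simp: power_le_one)
      then show "r0\<^sup>2 - r0 ^ (2 * p) \<le> 1" by linarith
    qed (use le s in auto)
    finally show ?thesis .
  qed
  have E1: "1 / (3 * s) \<le> E r1"
  proof -
    have "r1 ^ (2 * p) \<le> r1 ^ p" using r1 by (intro power_decreasing) auto
    also have "\<dots> \<le> s / 2" using dec by (simp add: r1_def)
    finally have "r1 ^ (2 * p) \<le> s / 2" .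
    moreover have r1sq: "r1\<^sup>2 = 1 - 2 * s + s * s" by (simp add: r1_def power2_eq_square algebra_simps)
    moreover have "s * s \<ge> 0" by simp
    ultimately have "2/3 \<le> r1\<^sup>2 - r1 ^ (2 * p)" using s(1,2) by linarith
    moreover have "1 - r1\<^sup>2 \<le> 2 * s" using r1sq by simp
    moreover have "s * s \<le> s * 1" using s(1,2) by (intro mult_left_mono) auto
    then have "1 - r1\<^sup>2 > 0" using r1sq s(1) by linarith
    ultimately have "(2/3) / (2 * s) \<le> (r1\<^sup>2 - r1 ^ (2 * p)) / (1 - r1\<^sup>2)"
      by (intro frac_le) auto
    also have "\<dots> = E r1" using Egeo[of r1] \<open>1 - r1\<^sup>2 > 0\<close> by (simp add: divide_eq_eq)
    finally show ?thesis by simp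
  qed
  \<comment> \<open>The constant 9/8 is the 1 from \<open>err_le\<close> plus 16/128 from
    \<open>lower\<close>. After multiplication by \<open>s\<close>, the left side is at least 1/768
    while the right side stays below that.\<close>
  have "E r1 / 256 \<le> 2 * E r0 + 160000 * (real p * real d * s) + 9/8"
    using main upper lower err_le by simp
  then have "(1 / (3 * s)) / 256 \<le> 2 * (1 / (4000 * s)) + 160000 * (real p * real d * s) + 9/8"
    using divide_right_mono[OF E1, of 256] mult_left_mono[OF E0, of 2] by simp
  then have "((1 / (3 * s)) / 256) * s \<le> (2 * (1 / (4000 * s)) + 160000 * (real p * real d * s) + 9/8) * s"
    using s by (intro mult_right_mono) auto
  moreover have "((1 / (3 * s)) / 256) * s = 1 / 768" using s(1) by simp
  moreover have "(2 * (1 / (4000 * s)) + 160000 * (real p * real d * s) + 9/8) * s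
      = 1 / 2000 + 160000 * (real p * real d * s\<^sup>2) + 9/8 * s"
    using s(1) by (simp add: field_simps power2_eq_square)
  ultimately have "1 / 768 \<le> 1 / 2000 + 160000 * (real p * real d * s\<^sup>2) + 9/8 * s" by simp
  moreover have "160000 * (real p * real d * s\<^sup>2) \<le> 160000 * (1/10^9)"
    using s(3) by (rule mult_left_mono) simp
  moreover have "9/8 * s \<le> 9/8 * (1/10000)" using s(2) by (rule mult_left_mono) simp
  ultimately have "(1/768::real) \<le> 1/2000 + 160000 * (1/10^9) + 9/8 * (1/10000)" by linarith
  then show False by simp
qed

section \<open>The choice of parameters and the final bound\<close>

lemma fekete_approximable_pos:
  assumes "fekete_approximable p N d"
  shows "d \<noteq> 0"
proof
  assume "d = 0"
  then obtain h G where h: "h \<noteq> 0" "degrees_le h 0" "subst_fps h G = 0"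
    using assms by (auto simp: fekete_approximable_def algebraic_fps_le_def)
  obtain q where q: "h = [:q:]" using h(2) by (auto simp: degrees_le_def elim: degree_eq_zeroE)
  have "degree q = 0" using h(2) unfolding degrees_le_def q by (metis coeff_pCons_0 le_zero_eq)
  then obtain c where "q = [:c:]" by (auto elim: degree_eq_zeroE)
  then show False using h(1,3) q by (simp add: subst_fps_def map_poly_pCons fps_of_poly_const)
qed

text \<open>If \<open>N\<close> were larger, \<open>s = 32 d ln p / N\<close> would satisfy
  \<open>p d s^2 <= 10^(-9)\<close>, while \<open>(1 - s)^N <= p^(-32 d)\<close> would beat all the
  polynomial losses in \<open>few_roots\<close>; together this is contradictory.\<close>

lemma fekete_approximable_bound:
  assumes p: "prime p" "200 \<le> p" and N: "2 \<le> N" "N < p" and approx: "fekete_approximable p N d"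
  shows "real N \<le> 2000000 * (real d * sqrt d * sqrt p * ln p)"
proof (rule ccontr)
  assume "\<not> ?thesis"
  then have big: "real N > 2000000 * (real d * sqrt d * sqrt p * ln p)" by simp
  define F where "F = fekete_cpoly p"
  have d1: "d \<ge> 1" using fekete_approximable_pos[OF approx] by simp
  have pr: "real p \<ge> 200" using p(2) by simp
  have p2: "2 < p" using p(2) by simp
  have lnp: "ln p \<ge> 1"
    using pr exp_le by (subst ln_ge_iff) auto
  have sq: "sqrt d \<ge> 1" "sqrt p \<ge> 1" using d1 pr by auto

  have Nd: "real N > 2000000 * d"
  proof -
    have "real d * 1 * 1 * 1 \<le> real d * sqrt d * sqrt p * ln p"
      using sq lnp by (intro mult_mono) auto
    then show ?thesis using big by linarith
  qed
  then have "2000000 * d < N" by linarith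
  then have dN: "d < N" "4 * (d + 1) \<le> N" "d + 1 \<le> p" using d1 N by simp_all

  define s where "s = 32 * real d * ln p / N"
  have spos: "s > 0" using d1 lnp N by (simp add: s_def)
  have sN: "s * N = 32 * real d * ln p" using N by (simp add: s_def)
  have ssq: "s * sqrt (d * p) \<le> 32 / 2000000"
  proof -
    have "s * (2000000 * (real d * sqrt d * sqrt p * ln p)) \<le> s * N"
      using big spos by (intro mult_left_mono) auto
    then have "(real d * ln p) * (s * sqrt (d * p) * 2000000) \<le> (real d * ln p) * 32"
      unfolding sN by (simp add: real_sqrt_mult mult_ac)
    moreover have "real d * ln p > 0" using d1 lnp by simp
    ultimately have "s * sqrt (d * p) * 2000000 \<le> 32" by (rule mult_left_le_imp_le)
    then show ?thesis by simp
  qed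
  have s1: "s \<le> 1/10000"
  proof -
    have "s * 1 \<le> s * sqrt (d * p)" using spos sq d1 pr by (intro mult_left_mono) (auto simp: real_sqrt_mult mult_ge1_I)
    then show ?thesis using ssq by simp
  qed
  have s2: "real p * real d * s\<^sup>2 \<le> 1/10^9"
  proof -
    have "(s * sqrt (d * p))\<^sup>2 \<le> (32 / 2000000)\<^sup>2" using ssq spos by (intro power_mono) auto
    then show ?thesis by (simp add: power_mult_distrib mult_ac power2_eq_square)
  qed
  have exp_le: "1 - s \<le> exp (- s)" using exp_ge_add_one_self[of "- s"] by simp
  have pow_le: "(1 - s) ^ n \<le> exp (- (s * n))" for n :: nat
  proof -
    have "(1 - s) ^ n \<le> exp (- s) ^ n" using exp_le s1 by (intro power_mono) auto
    also have "\<dots> = exp (- (s * n))" by (simp add: mult.commute flip: exp_of_nat_mult)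
    finally show ?thesis .
  qed
  have dec: "(1 - s) ^ p \<le> s / 2"
  proof -
    have "real d * ln p \<ge> 1 * ln p" using d1 lnp by (intro mult_right_mono) auto
    then have "s * p \<ge> ln p"
      using sN mult_left_mono[of "real N" "real p" s] N spos lnp by linarith
    then have "(1 - s) ^ p \<le> exp (- ln p)" using pow_le[of p] exp_le_cancel_iff[of "- (s * p)" "- ln p"] by linarith
    also have "\<dots> = 1 / p" using pr by (simp add: exp_minus inverse_eq_divide)
    also have "\<dots> \<le> 1 / N" using N by (intro frac_le) auto
    also have "\<dots> \<le> s / 2"
    proof -
      have "1 * 1 \<le> real d * ln p" using d1 lnp by (intro mult_mono) auto
      then show ?thesis using N by (simp add: s_def field_simps)
    qed
    finally show ?thesis .
  qed

  obtain h0 G where h0: "h0 \<noteq> 0" "degrees_le h0 d" "subst_fps h0 G = 0"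
    and G: "fps_X ^ N dvd fps_of_poly F - G"
    using approx by (auto simp: fekete_approximable_def algebraic_fps_le_def F_def fekete_cpoly_def)
  obtain h i j where h: "degrees_le h d" "\<And>i j. norm (coeff (coeff h j) i) \<le> 1"
    and hij: "norm (coeff (coeff h j) i) = 1" "i \<le> d"
    and hh: "\<And>F n. coeff (poly h0 F) n = 0 \<Longrightarrow> coeff (poly h F) n = 0"
  proof (rule normalize_bivariate[OF h0(1,2)])
    fix h' i j
    assume *: "degrees_le h' d" "\<And>i j. norm (coeff (coeff h' j) i) \<le> 1"
      "norm (coeff (coeff h' j) i) = 1" "i \<le> d" "\<And>F n. coeff (poly h0 F) n = 0 \<Longrightarrow> coeff (poly h' F) n = 0"
    show thesis by (rule that[OF *])
  qed
  have vanish: "coeff (poly h F) n = 0" if "n < N" for n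
    by (rule hh[OF coeff_poly_eq_0_of_approx[OF G h0(3) that]])
  \<comment> \<open>The coefficient of \<open>X^i\<close> in \<open>h\<close>, read as a polynomial
    in \<open>Y\<close>. By the choice of \<open>i\<close> it has a coefficient of modulus 1, so it
    is not small away from its roots; \<open>B\<close> holds their moduli.\<close>
  define q where "q = map_poly (\<lambda>c. coeff c i) h"
  have cq: "coeff q j = coeff (coeff h j) i" for j by (simp add: q_def coeff_map_poly)
  have q0: "q \<noteq> 0" using hij(1) cq[of j] by auto
  have degq: "degree q \<le> d" using h(1) by (intro degree_le) (auto simp: cq coeff_eq_0 degrees_le_def)
  define B where "B = norm ` set_mset (proots q)"
  have finB: "finite B" by (simp add: B_def)
  have cardB: "card B \<le> d"
  proof -
    have "card B \<le> card (set_mset (proots q))" unfolding B_def by (intro card_image_le) simp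
    also have "\<dots> \<le> degree q" using q0 by (simp add: card_poly_roots_bound)
    also have "\<dots> \<le> d" by (rule degq)
    finally show ?thesis .
  qed
  have Fc: "norm (coeff F n) \<le> 1" for n by (simp add: F_def norm_coeff_fekete_cpoly[OF p(1) p2])
  have degF: "degree F < p" "degree F > 0" using p2 by (simp_all add: F_def degree_fekete_cpoly_eq[OF p(1) p2])

  show False
  proof (rule fekete_few_roots_contradiction[OF p(1) p2 spos s1 s2 dec finB cardB])
    fix w :: complex
    assume w: "1 \<le> norm w" "norm w \<le> 16 * p"
      and sep: "\<And>b. b \<in> B \<Longrightarrow> \<bar>norm w - b\<bar> \<ge> 1 / (4 * (real d + 1))"
    have dp: "real d + 1 \<le> p" using dN(3) by linarith
    \<comment> \<open>The separation lemma is applied with \<open>k = p^(-3)\<close>: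
      \<open>(1 + 2 |w|) * 4 (d + 1) <= 132 p^2 <= p^3\<close>.\<close>
    have low: "norm (poly q w) \<ge> (1 / real p ^ 3) ^ d"
    proof (rule norm_poly_ge_of_separated[OF degq, of j])
      show "norm (coeff q j) \<ge> 1" using hij cq by simp
      show "\<bar>norm w - norm a\<bar> \<ge> 1 / (4 * (real d + 1))" if "a \<in># proots q" for a
        using sep that by (simp add: B_def)
      show "1 / real p ^ 3 \<le> 1/4"
      proof -
        have "real p ^ 1 \<le> real p ^ 3" using pr by (intro power_increasing) auto
        then have "real p ^ 3 \<ge> 4" using pr unfolding power_one_right by linarith
        then show ?thesis by (intro frac_le) auto
      qed
      have "(1 + 2 * norm w) * (4 * (real d + 1)) \<le> (33 * real p) * (4 * real p)"
        using w pr dp by (intro mult_mono) auto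
      also have "\<dots> = 132 * (real p * p)" by simp
      also have "\<dots> \<le> real p * (real p * p)" using pr by (intro mult_right_mono) auto
      also have "\<dots> = real p ^ 3" by (simp add: power3_eq_cube)
      finally show "1 / real p ^ 3 * (1 + 2 * norm w) \<le> 1 / (4 * (real d + 1))"
        using pr by (simp add: field_simps)
    qed (use w in auto)
    let ?M = "N - 2 * (d + 1)"
    \<comment> \<open>The exponent is still at least \<open>N / 2\<close>, so half of the saving
      \<open>p^(-32 d)\<close> remains.\<close>
    have M: "(1 - s) ^ ?M \<le> 1 / real p ^ (16 * d)"
    proof -
      have "real N / 2 \<le> real ?M" using dN(2) by linarith
      then have "s * (real N / 2) \<le> s * real ?M" using spos by (intro mult_left_mono) auto
      then have "exp (- (s * real ?M)) \<le> exp (- (real (16 * d) * ln p))"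
        using sN by simp
      also have "\<dots> = 1 / real p ^ (16 * d)"
        using pr by (simp add: exp_minus exp_of_nat_mult inverse_eq_divide del: of_nat_mult)
      finally show ?thesis using pow_le[of ?M] by linarith
    qed
    have "2 ^ (d + 1) * (((real d + 1)\<^sup>2 * real p ^ d) * real (d * p) ^ (d + 1) * (1 - s) ^ ?M)
      \<le> real p ^ (d + 1) * (((real p)\<^sup>2 * real p ^ d) * (real p * real p) ^ (d + 1) * (1 / real p ^ (16 * d)))"
      using pr dp M s1 by (intro mult_mono power_mono) auto
    also have "\<dots> = real p ^ (4 * d + 5) / real p ^ (16 * d)"
    proof -
      have "(real p * real p) ^ (d + 1) = real p ^ (d + 1 + (d + 1))"
        by (simp only: power_mult_distrib power_add[of _ "d + 1" "d + 1"])
      moreover have "4 * d + 5 = (d + 1) + (2 + d + (d + 1 + (d + 1)))" by simp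
      ultimately show ?thesis
        by (simp only: power_add times_divide_eq_right mult_1_right mult.assoc)
    qed
    \<comment> \<open>The losses amount to \<open>p^(4d+5)\<close>, at most \<open>p^(9d)\<close>
      because \<open>d >= 1\<close>. Against \<open>p^(16 d)\<close> this leaves less than
      \<open>p^(-3d)\<close>, the lower bound for \<open>q\<close>.\<close>
    also have "\<dots> \<le> real p ^ (9 * d) / real p ^ (16 * d)"
      using pr d1 by (intro divide_right_mono power_increasing) auto
    also have "\<dots> < real p ^ (13 * d) / real p ^ (16 * d)"
      using pr d1 by (intro divide_strict_right_mono power_strict_increasing) auto
    also have "\<dots> = (1 / real p ^ 3) ^ d"
    proof -
      have "real p ^ (16 * d) = real p ^ (13 * d) * real p ^ (3 * d)" by (simp flip: power_add)
      then show ?thesis using pr by (simp add: power_one_over power_mult)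
    qed
    also have "\<dots> \<le> norm (poly q w)" by (rule low)
    finally have bound: "2 ^ (d + 1) * (((real d + 1)\<^sup>2 * real p ^ d) * real (d * p) ^ (d + 1) * (1 - s) ^ ?M)
       < norm (poly q w)" .
    show "size (filter_mset (\<lambda>a. norm a < 1 - s) (proots (fekete_cpoly p - [:w:]))) \<le> d"
      unfolding F_def[symmetric]
    proof (rule few_roots[OF Fc degF h vanish dN(1) _ _ hij(2) bound[unfolded q_def]])
    qed (use spos s1 in auto)
  qed
qed

theorem theorem1p1:
  shows "\<exists>(c::real) (p0::nat). c > 0 \<and>
    (\<forall>(p::nat) (N::nat). prime p \<and> p \<ge> p0 \<and> 2 \<le> N \<and> N < p \<longrightarrow>
      real (fekete_alg_degree p N)
        \<ge> c * (real N / (real p powr (1/2) * ln (real p))) powr (1/10))"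
proof -
  define C :: real where "C = 2000000"
  have "real (fekete_alg_degree p N) \<ge> (1 / C powr (1/10)) * (real N / (real p powr (1/2) * ln (real p))) powr (1/10)"
    if p: "prime p" "p \<ge> 200" and N: "2 \<le> N" "N < p" for p N :: nat
  proof -
    define d where "d = fekete_alg_degree p N"
    have approx: "fekete_approximable p N d"
      unfolding d_def fekete_alg_degree_def using fekete_approximable_exists by (rule LeastI_ex)
    have d1: "real d \<ge> 1" using fekete_approximable_pos[OF approx] by simp
    have pos: "sqrt p * ln p > 0" using p(2) by simp
    have "real N \<le> C * (real d * sqrt d * sqrt p * ln p)"
      using fekete_approximable_bound[OF p N approx] by (simp add: C_def)
    then have "real N / (sqrt p * ln p) \<le> C * (real d * sqrt d)"
      using pos by (simp add: pos_divide_le_eq mult_ac)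
    \<comment> \<open>As \<open>d >= 1\<close>, the power \<open>d^(3/2)\<close> may be raised to
      \<open>d^2\<close> and then to \<open>d^10\<close>, whose tenth root gives the stated
      exponent.\<close>
    also have "\<dots> \<le> C * (real d * real d)"
    proof -
      have "sqrt d * 1 \<le> sqrt d * sqrt d" using d1 by (intro mult_left_mono) auto
      then show ?thesis using d1 by (intro mult_left_mono) (auto simp: C_def)
    qed
    also have "\<dots> \<le> C * real d ^ 10"
      using power_increasing[of 2 10 "real d"] d1 by (intro mult_left_mono) (auto simp: power2_eq_square C_def)
    finally have "(real N / (sqrt p * ln p)) powr (1/10) \<le> (C * real d ^ 10) powr (1/10)"
      using pos by (intro powr_mono2) auto
    also have "\<dots> = C powr (1/10) * (real d ^ 10) powr (1/10)"
      by (rule powr_mult)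
    also have "(real d ^ 10) powr (1/10) = (real d powr real 10) powr (1/10)"
      using d1 by (subst powr_realpow) auto
    also have "\<dots> = real d" unfolding powr_powr using d1 by simp
    finally have "(real N / (sqrt p * ln p)) powr (1/10) \<le> C powr (1/10) * real d" .
    moreover have "C powr (1/10) > 0" by (simp add: C_def)
    ultimately have "(real N / (sqrt p * ln p)) powr (1/10) / C powr (1/10) \<le> real d"
      by (subst pos_divide_le_eq) (simp_all only: mult.commute)
    then show ?thesis
      unfolding d_def[symmetric] by (simp add: powr_half_sqrt)
  qed
  moreover have "1 / C powr (1/10) > 0" by (simp add: C_def)
  ultimately show ?thesis by blast
qed

end
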